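(* For any $a>0$ such that $\chi^2(P_0,P_a)<\infty$, $\alpha>0$, $d\ge4$, $1\le s\le d$, $n\ge1$, we have $$\inf_{Q\in\mathcal{Q}_\alpha}\inf_{\hat\eta\in\mathcal{T}}\sup_{\theta\in\Theta_d^+(s,a)}\mathbb{E}_{Q(P_\theta^{\otimes n})}|\hat\eta-\eta|\ \ge\ \frac14\Bigl(1-\frac{2n(e^\alpha-1)^2}{d\log(d)}\chi^2(P_0,P_a)\Bigr).$$ Assume now that the law $P^{\xi_1}$ of the noise coordinates is strongly log-concave with density $p=\exp(-\phi)$ whose potential $\phi$ has curvature bounded from above by a constant $c_+>0$, i.e. $\phi(tx+(1-t)y)-[t\phi(x)+(1-t)\phi(y)]\ge-\frac{c_+}2t(1-t)(x-y)^2$ for all $x,y\in\mathbb{R}$, $t\in(0,1)$. Then $$\chi^2(P_0,P_a)\le\exp\Bigl(c_+\Bigl(\frac a\sigma\Bigr)^2\Bigr)-1 .$$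
   Context: Model: $\sigma>0$, $\theta\in\mathbb{R}^d$; $X^1,\dots,X^n$ are i.i.d. random vectors in $\mathbb{R}^d$ with law $P_\theta$, $X^i=\theta+\sigma\xi^i$, where $\xi^i$ has i.i.d. coordinates distributed as $\xi_1$, whose law $P^{\xi_1}$ on $\mathbb{R}$ is symmetric around $0$, has variance $1$ and is $c$-strongly log-concave for a constant $c>0$: it has density $p(x)=\exp(-\phi_0(x))\exp(-cx^2/2)$ with $\phi_0:\mathbb{R}\to\mathbb{R}$ a finite even convex function. The potential of $p$ is $\phi=-\log p$. $P_0$ is the law of $\sigma\xi_1$ and $P_a$ the law of $a+\sigma\xi_1$ on $\mathbb{R}$; $\chi^2(P_0,P_a)=\int\bigl(\frac{dP_a}{dP_0}\bigr)^2dP_0-1$. $\Theta_d^+(s,a)$ is the set of $\theta\in\mathbb{R}^d$ for which there is $S\subseteq\{1,\dots,d\}$ with at most $s$ elements such that $\theta_j\ge a$ for $j\in S$ and $\theta_j=0$ for $j\notin S$. Put $\eta=(I(\theta_j\ne0))_{j=1,\dots,d}$ and $|\hat\eta-\eta|=\sum_{j=1}^d I(\hat\eta_j\neq\eta_j)$. $\mathcal{Q}_\alpha$ is the set of all non-interactive $\alpha$-locally differentially private mechanisms: sequences $Q=(Q^1,\dots,Q^n)$ of Markov kernels from $\mathbb{R}^d$ to $\mathbb{R}^d$ with $Q^i(A\mid x)\le e^\alpha Q^i(A\mid x')$ for all $i$, all measurable $A$, all $x,x'\in\mathbb{R}^d$; given the $X^i$, the $Z^i\sim Q^i(\cdot\mid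 X^i)$ are drawn independently, and $Q(P_\theta^{\otimes n})$ denotes the law of $(Z^1,\dots,Z^n)$. $\mathcal{T}$ is the set of separable selectors: measurable $\hat\eta=\hat\eta(Z^1,\dots,Z^n)\in\{0,1\}^d$ such that for each $j$, $\hat\eta_j$ depends only on $(Z^i_j)_{i=1,\dots,n}$. *)

theory Defs
  imports "HOL-Probability.Probability"
begin

definition strongly_log_concave_density :: "real \<Rightarrow> (real \<Rightarrow> real) \<Rightarrow> bool" where
  "strongly_log_concave_density c p \<longleftrightarrow>
     (\<exists>\<phi>0. convex_on UNIV \<phi>0 \<and> (\<forall>x. \<phi>0 (- x) = \<phi>0 x) \<and>
           (\<forall>x. p x = exp (- \<phi>0 x) * exp (- c * x\<^sup>2 / 2)))"

definition potential :: "(real \<Rightarrow> real) \<Rightarrow> real \<Rightarrow> real" where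
  "potential p x = - ln (p x)"

definition curvature_bounded_above :: "real \<Rightarrow> (real \<Rightarrow> real) \<Rightarrow> bool" where
  "curvature_bounded_above c \<phi> \<longleftrightarrow>
     (\<forall>x y t. 0 < t \<and> t < 1 \<longrightarrow>
        \<phi> (t * x + (1 - t) * y) - (t * \<phi> x + (1 - t) * \<phi> y)
          \<ge> - (c / 2) * t * (1 - t) * (x - y)\<^sup>2)"

text \<open>\<open>\<mu>\<close> is the law of a single noise coordinate; \<open>coord_law \<mu> \<sigma> a\<close> is the law \<open>P\<^sub>a\<close> on the
  real line and \<open>signal_law \<mu> \<sigma> \<theta>\<close> is the law \<open>P\<^sub>\<theta>\<close> of one observation.\<close>

definition coord_law :: "real measure \<Rightarrow> real \<Rightarrow> real \<Rightarrow> real measure" where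
  "coord_law \<mu> \<sigma> a = distr \<mu> borel (\<lambda>x. a + \<sigma> * x)"

definition signal_law :: "real measure \<Rightarrow> real \<Rightarrow> real ^ 'd \<Rightarrow> (real ^ 'd) measure" where
  "signal_law \<mu> \<sigma> \<theta> =
     distr (Pi\<^sub>M (UNIV :: 'd set) (\<lambda>_. \<mu>)) borel (\<lambda>\<xi>. \<chi> j. \<theta> $ j + \<sigma> * \<xi> j)"

text \<open>The argument order is that of \<open>\<chi>\<^sup>2(P, Q) = \<integral> (dQ/dP)\<^sup>2 dP - 1\<close>, with value \<open>\<infinity>\<close> if \<open>dQ/dP\<close> does
  not exist. The subtraction on \<^typ>\<open>ennreal\<close> does not truncate for probability measures, since the
  integral is then at least 1.\<close>

definition chi2 :: "'a measure \<Rightarrow> 'a measure \<Rightarrow> ennreal" where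
  "chi2 P Q = (if absolutely_continuous P Q
               then (\<integral>\<^sup>+ x. (RN_deriv P Q x)\<^sup>2 \<partial>P) - 1 else \<infinity>)"

definition Theta_plus :: "nat \<Rightarrow> real \<Rightarrow> (real ^ 'd) set" where
  "Theta_plus s a =
     {\<theta>. \<exists>S. card S \<le> s \<and> (\<forall>j\<in>S. \<theta> $ j \<ge> a) \<and> (\<forall>j. j \<notin> S \<longrightarrow> \<theta> $ j = 0)}"

text \<open>Users are indexed by \<open>{1..n}\<close>; the values of \<open>Q i\<close> for other \<open>i\<close> are immaterial.\<close>

definition ldp_mechanisms ::
    "nat \<Rightarrow> real \<Rightarrow> (nat \<Rightarrow> real ^ 'd \<Rightarrow> (real ^ 'd) measure) set" where
  "ldp_mechanisms n \<alpha> =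
     {Q. \<forall>i\<in>{1..n}. Q i \<in> borel \<rightarrow>\<^sub>M prob_algebra borel \<and>
           (\<forall>A\<in>sets borel. \<forall>x x'. measure (Q i x) A \<le> exp \<alpha> * measure (Q i x') A)}"

definition privatized_law ::
    "nat \<Rightarrow> (nat \<Rightarrow> real ^ 'd \<Rightarrow> (real ^ 'd) measure) \<Rightarrow> (real ^ 'd) measure
       \<Rightarrow> (nat \<Rightarrow> real ^ 'd) measure" where
  "privatized_law n Q P =
     Pi\<^sub>M {1..n} (\<lambda>_. P) \<bind> (\<lambda>x. Pi\<^sub>M {1..n} (\<lambda>i. Q i (x i)))"

text \<open>Elements of \<open>{0,1}\<^sup>d\<close> are encoded as functions into \<^typ>\<open>bool\<close>, with \<open>True\<close> for 1.\<close>

definition separable_selectors ::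
    "nat \<Rightarrow> ((nat \<Rightarrow> real ^ 'd) \<Rightarrow> 'd \<Rightarrow> bool) set" where
  "separable_selectors n =
     {h. \<forall>j. (\<lambda>z. h z j) \<in> Pi\<^sub>M {1..n} (\<lambda>_. borel) \<rightarrow>\<^sub>M count_space UNIV \<and>
             (\<forall>z \<in> space (Pi\<^sub>M {1..n} (\<lambda>_. borel)). \<forall>z' \<in> space (Pi\<^sub>M {1..n} (\<lambda>_. borel)).
                (\<forall>i\<in>{1..n}. z i $ j = z' i $ j) \<longrightarrow> h z j = h z' j)}"

definition support_indicator :: "real ^ 'd \<Rightarrow> 'd \<Rightarrow> bool" where
  "support_indicator \<theta> j \<longleftrightarrow> \<theta> $ j \<noteq> 0"

definition hamming :: "('d::finite \<Rightarrow> bool) \<Rightarrow> ('d \<Rightarrow> bool) \<Rightarrow> real" where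
  "hamming u v = (\<Sum>j\<in>UNIV. of_bool (u j \<noteq> v j))"

end

theory Submission imports Defs begin

text \<open>Compare the null parameter \<open>0\<close> with the alternatives \<open>a e\<^sub>j\<close>. For each \<open>j\<close>, a test of the privatized
  null law \<open>M\<^sub>0\<close> (weighted by \<open>d\<close>) against \<open>M\<^sub>j\<close> has weighted error at least \<open>\<integral> min(L\<^sub>j, d) dM\<^sub>0\<close>, which
  is at least \<open>1/2 - KL(M\<^sub>j, M\<^sub>0) / ln d\<close>; this is the source of the logarithm. The divergences add up
  over the users, and for one user the sum over \<open>j\<close> of the \<open>\<chi>\<^sup>2\<close> divergences of the privatized laws is at
  most \<open>(e\<^sup>\<alpha> - 1)\<^sup>2 \<chi>\<^sup>2(P\<^sub>0, P\<^sub>a)\<close>, because the functions \<open>dP\<^sub>a/dP\<^sub>0(x\<^sub>j) - 1\<close> are orthogonal under the null.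
  The second claim is the curvature inequality at the midpoint of \<open>y\<close> and \<open>y - 2a/\<sigma>\<close>.\<close>

text \<open>Over independent users \<open>1 + chi2\<close> multiplies, whereas the Kullback-Leibler
  divergence adds up. Hence chi-square is used for one user at a time only, and
  \<open>ln t \<le> t - 1\<close> converts it before the users are combined. Orthogonality produces
  the \<open>1 / d\<close> in the bound: a user has a single amount
  \<open>(exp \<alpha> - 1)\<^sup>2 * chi2\<close> to spend on all \<open>d\<close> alternatives
  together, so an average alternative receives only a fraction \<open>1 / d\<close> of it. The
  weight \<open>d\<close> of the null errors balances the two sides. Adding \<open>d\<close> times
  the false selections under the null and the missed coordinates under the \<open>d\<close>
  alternatives gives at most \<open>d\<close> times the null risk plus \<open>d\<close> further
  risks. If all of these lie below \<beta>, the total is below \<open>2 * d * \<beta>\<close>, while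
  it is at least \<open>d / 2 - n * (exp \<alpha> - 1)\<^sup>2 * chi2 / ln d\<close>. Dividing by
  \<open>2 * d\<close> yields the factor 1/4 and the 2 inside the bracket.\<close>

section \<open>Finite products of probability spaces\<close>

text \<open>The library locales for products ask for a probability space at every index, also outside
  the index set of the product.\<close>

lemma product_prob_space_extend:
  assumes "\<And>i. i \<in> I \<Longrightarrow> prob_space (M i)"
  obtains M' where "product_prob_space M'" "Pi\<^sub>M I M = Pi\<^sub>M I M'" "\<And>i. i \<in> I \<Longrightarrow> M' i = M i"
proof
  let ?M' = "\<lambda>i. if i \<in> I then M i else return (count_space UNIV) undefined"
  show "product_prob_space ?M'"
    using assms by (intro product_prob_spaceI) (auto intro!: prob_space_return)
  show "Pi\<^sub>M I M = Pi\<^sub>M I ?M'" by (intro PiM_cong) auto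
qed simp

lemma emeasure_PiM_prob_space:
  assumes "finite I" "\<And>i. i \<in> I \<Longrightarrow> prob_space (M i)" "\<And>i. i \<in> I \<Longrightarrow> A i \<in> sets (M i)"
  shows "emeasure (Pi\<^sub>M I M) (Pi\<^sub>E I A) = (\<Prod>i\<in>I. emeasure (M i) (A i))"
proof -
  obtain M' where M': "product_prob_space M'" "Pi\<^sub>M I M = Pi\<^sub>M I M'" "\<And>i. i \<in> I \<Longrightarrow> M' i = M i"
    using product_prob_space_extend assms(2) by metis
  interpret product_prob_space M' by fact
  show ?thesis using assms M' by (simp add: emeasure_PiM)
qed

lemma PiM_eqI_prob_space:
  assumes "finite I" "\<And>i. i \<in> I \<Longrightarrow> prob_space (M i)" "sets P = sets (Pi\<^sub>M I M)"
    and "\<And>A. (\<And>i. i \<in> I \<Longrightarrow> A i \<in> sets (M i)) \<Longrightarrow>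
      emeasure P (Pi\<^sub>E I A) = (\<Prod>i\<in>I. emeasure (M i) (A i))"
  shows "P = Pi\<^sub>M I M"
proof -
  obtain M' where M': "product_prob_space M'" "Pi\<^sub>M I M = Pi\<^sub>M I M'" "\<And>i. i \<in> I \<Longrightarrow> M' i = M i"
    using product_prob_space_extend assms(2) by metis
  interpret product_prob_space M' by fact
  show ?thesis unfolding M'(2) using assms M'(2,3) by (intro PiM_eqI) auto
qed

lemma nn_integral_PiM_prod:
  assumes "finite I" "\<And>i. i \<in> I \<Longrightarrow> prob_space (M i)" "\<And>i. i \<in> I \<Longrightarrow> f i \<in> borel_measurable (M i)"
  shows "(\<integral>\<^sup>+x. (\<Prod>i\<in>I. f i (x i)) \<partial>Pi\<^sub>M I M) = (\<Prod>i\<in>I. integral\<^sup>N (M i) (f i))"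
proof -
  obtain M' where M': "product_prob_space M'" "Pi\<^sub>M I M = Pi\<^sub>M I M'" "\<And>i. i \<in> I \<Longrightarrow> M' i = M i"
    using product_prob_space_extend assms(2) by metis
  interpret product_prob_space M' by fact
  show ?thesis unfolding M'(2) using assms M'(3) by (simp add: product_nn_integral_prod)
qed

lemma measurable_PiM_component_compose:
  assumes "i \<in> I" "f \<in> M i \<rightarrow>\<^sub>M N"
  shows "(\<lambda>x. f (x i)) \<in> Pi\<^sub>M I M \<rightarrow>\<^sub>M N"
  by (rule measurable_compose[where f = "\<lambda>x. x i" and g = f, OF _ assms(2)])
     (rule measurable_component_singleton[OF assms(1)])

text \<open>Boxes form an intersection-stable generator, and since \<open>I\<close> is finite the
  mass of a box is a finite product of measurable functions of the single coordinates.\<close>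

lemma measurable_PiM_kernel:
  assumes I: "finite I" and K: "\<And>i. i \<in> I \<Longrightarrow> K i \<in> M i \<rightarrow>\<^sub>M prob_algebra (N i)"
  shows "(\<lambda>x. Pi\<^sub>M I (\<lambda>i. K i (x i))) \<in> Pi\<^sub>M I M \<rightarrow>\<^sub>M prob_algebra (Pi\<^sub>M I N)"
proof (rule measurable_prob_algebra_generated[OF sets_PiM Int_stable_prod_algebra prod_algebra_sets_into_space])
  have Kx: "prob_space (K i (x i))" "sets (K i (x i)) = sets (N i)"
    if "i \<in> I" "x \<in> space (Pi\<^sub>M I M)" for i x
    using measurable_space[OF K[OF that(1)], of "x i"] that
    by (auto simp: space_prob_algebra space_PiM)
  show "prob_space (Pi\<^sub>M I (\<lambda>i. K i (x i)))" if "x \<in> space (Pi\<^sub>M I M)" for x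
    using Kx that by (intro prob_space_PiM) auto
  show "sets (Pi\<^sub>M I (\<lambda>i. K i (x i))) = sets (Pi\<^sub>M I N)" if "x \<in> space (Pi\<^sub>M I M)" for x
    using Kx that by (intro sets_PiM_cong) auto
  fix A assume "A \<in> prod_algebra I N"
  then obtain E where A: "A = Pi\<^sub>E I E" and E: "\<And>i. i \<in> I \<Longrightarrow> E i \<in> sets (N i)"
    using prod_algebra_eq_finite[OF I, of N] by (auto simp: Pi_iff)
  have "emeasure (Pi\<^sub>M I (\<lambda>i. K i (x i))) A = (\<Prod>i\<in>I. emeasure (K i (x i)) (E i))"
    if "x \<in> space (Pi\<^sub>M I M)" for x
    unfolding A using I E Kx that by (intro emeasure_PiM_prob_space) auto
  moreover have "(\<lambda>x. \<Prod>i\<in>I. emeasure (K i (x i)) (E i)) \<in> borel_measurable (Pi\<^sub>M I M)"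
  proof (rule borel_measurable_prod_ennreal)
    fix i assume i: "i \<in> I"
    show "(\<lambda>x. emeasure (K i (x i)) (E i)) \<in> borel_measurable (Pi\<^sub>M I M)"
      by (rule measurable_PiM_component_compose[where M = M and f = "\<lambda>y. emeasure (K i y) (E i)", OF i
            measurable_compose[OF measurable_prob_algebraD[OF K[OF i]]
            measurable_emeasure_subprob_algebra[OF E[OF i]]]])
  qed
  ultimately show "(\<lambda>x. emeasure (Pi\<^sub>M I (\<lambda>i. K i (x i))) A) \<in> borel_measurable (Pi\<^sub>M I M)"
    by (simp cong: measurable_cong)
qed

text \<open>Users who randomize separately keep their outputs independent: on a box the integrand
  factorizes over the coordinates, and so does its integral. This is what non-interactivity of the
  mechanism provides.\<close>

lemma PiM_bind:
  assumes I: "finite I" and M: "\<And>i. i \<in> I \<Longrightarrow> prob_space (M i)"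
    and K: "\<And>i. i \<in> I \<Longrightarrow> K i \<in> M i \<rightarrow>\<^sub>M prob_algebra (N i)"
  shows "Pi\<^sub>M I M \<bind> (\<lambda>x. Pi\<^sub>M I (\<lambda>i. K i (x i))) = Pi\<^sub>M I (\<lambda>i. M i \<bind> K i)"
proof (rule PiM_eqI_prob_space[OF I])
  have Mi: "M i \<in> space (prob_algebra (M i))" if "i \<in> I" for i
    using M[OF that] by (simp add: space_prob_algebra)
  have PM: "Pi\<^sub>M I M \<in> space (prob_algebra (Pi\<^sub>M I M))"
    using M by (simp add: space_prob_algebra prob_space_PiM)
  note PK = measurable_PiM_kernel[of I K M N, OF I K]
  show "prob_space (M i \<bind> K i)" if "i \<in> I" for i
    by (rule prob_space_bind'[OF Mi[OF that] K[OF that]])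
  have sK: "sets (M i \<bind> K i) = sets (N i)" if "i \<in> I" for i
    by (rule sets_bind'[OF Mi[OF that] K[OF that]])
  show "sets (Pi\<^sub>M I M \<bind> (\<lambda>x. Pi\<^sub>M I (\<lambda>i. K i (x i)))) = sets (Pi\<^sub>M I (\<lambda>i. M i \<bind> K i))"
    by (subst sets_bind'[OF PM PK]) (auto intro!: sets_PiM_cong simp: sK)
  fix A assume "\<And>i. i \<in> I \<Longrightarrow> A i \<in> sets (M i \<bind> K i)"
  then have A: "\<And>i. i \<in> I \<Longrightarrow> A i \<in> sets (N i)" using sK by auto
  have Kx: "prob_space (K i (x i))" "sets (K i (x i)) = sets (N i)"
    if "i \<in> I" "x \<in> space (Pi\<^sub>M I M)" for i x
    using measurable_space[OF K[OF that(1)], of "x i"] that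
    by (auto simp: space_prob_algebra space_PiM)
  have "emeasure (Pi\<^sub>M I M \<bind> (\<lambda>x. Pi\<^sub>M I (\<lambda>i. K i (x i)))) (Pi\<^sub>E I A) =
      (\<integral>\<^sup>+x. emeasure (Pi\<^sub>M I (\<lambda>i. K i (x i))) (Pi\<^sub>E I A) \<partial>Pi\<^sub>M I M)"
    by (rule emeasure_bind_prob_algebra[OF PM PK]) (use I A in \<open>auto intro!: sets_PiM_I_finite\<close>)
  also have "\<dots> = (\<integral>\<^sup>+x. (\<Prod>i\<in>I. emeasure (K i (x i)) (A i)) \<partial>Pi\<^sub>M I M)"
    using I A Kx by (intro nn_integral_cong emeasure_PiM_prob_space) auto
  also have "\<dots> = (\<Prod>i\<in>I. \<integral>\<^sup>+y. emeasure (K i y) (A i) \<partial>M i)"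
    by (rule nn_integral_PiM_prod[OF I M])
       (auto intro!: measurable_compose[OF measurable_prob_algebraD[OF K]
            measurable_emeasure_subprob_algebra] A)
  also have "\<dots> = (\<Prod>i\<in>I. emeasure (M i \<bind> K i) (A i))"
    by (intro prod.cong refl emeasure_bind_prob_algebra[symmetric, OF Mi K] A)
  finally show "emeasure (Pi\<^sub>M I M \<bind> (\<lambda>x. Pi\<^sub>M I (\<lambda>i. K i (x i)))) (Pi\<^sub>E I A) =
    (\<Prod>i\<in>I. emeasure (M i \<bind> K i) (A i))" .
qed

text \<open>The likelihood ratio of product laws is the product of the ratios. It serves twice: over
  the users of the privatized sample and over the coordinates of one observation.\<close>

lemma PiM_density:
  fixes f :: "'i \<Rightarrow> 'a \<Rightarrow> ennreal"
  assumes I: "finite I" and M: "\<And>i. i \<in> I \<Longrightarrow> prob_space (M i)"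
    and f: "\<And>i. i \<in> I \<Longrightarrow> f i \<in> borel_measurable (M i)"
    and D: "\<And>i. i \<in> I \<Longrightarrow> prob_space (density (M i) (f i))"
  shows "density (Pi\<^sub>M I M) (\<lambda>x. \<Prod>i\<in>I. f i (x i)) = Pi\<^sub>M I (\<lambda>i. density (M i) (f i))"
proof (rule PiM_eqI_prob_space[OF I D])
  show "sets (density (Pi\<^sub>M I M) (\<lambda>x. \<Prod>i\<in>I. f i (x i))) = sets (Pi\<^sub>M I (\<lambda>i. density (M i) (f i)))"
    by (simp cong: sets_PiM_cong)
  fix A assume "\<And>i. i \<in> I \<Longrightarrow> A i \<in> sets (density (M i) (f i))"
  then have A: "A i \<in> sets (M i)" if "i \<in> I" for i using that by simp
  have [measurable]: "(\<lambda>x. \<Prod>i\<in>I. f i (x i)) \<in> borel_measurable (Pi\<^sub>M I M)"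
    by (intro borel_measurable_prod_ennreal measurable_PiM_component_compose f)
  have "emeasure (density (Pi\<^sub>M I M) (\<lambda>x. \<Prod>i\<in>I. f i (x i))) (Pi\<^sub>E I A) =
      (\<integral>\<^sup>+x. (\<Prod>i\<in>I. f i (x i)) * indicator (Pi\<^sub>E I A) x \<partial>Pi\<^sub>M I M)"
    using I A by (subst emeasure_density) (auto intro!: sets_PiM_I_finite)
  also have "\<dots> = (\<integral>\<^sup>+x. (\<Prod>i\<in>I. f i (x i) * indicator (A i) (x i)) \<partial>Pi\<^sub>M I M)"
  proof (rule nn_integral_cong)
    fix x assume "x \<in> space (Pi\<^sub>M I M)"
    then have "indicator (Pi\<^sub>E I A) x = (\<Prod>i\<in>I. indicator (A i) (x i) :: ennreal)"
      using I by (auto simp: indicator_def PiE_iff space_PiM)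
    then show "(\<Prod>i\<in>I. f i (x i)) * indicator (Pi\<^sub>E I A) x =
        (\<Prod>i\<in>I. f i (x i) * indicator (A i) (x i))"
      by (simp add: prod.distrib)
  qed
  also have "\<dots> = (\<Prod>i\<in>I. \<integral>\<^sup>+y. f i y * indicator (A i) y \<partial>M i)"
    using f A by (intro nn_integral_PiM_prod I M) auto
  also have "\<dots> = (\<Prod>i\<in>I. emeasure (density (M i) (f i)) (A i))"
    using f A by (intro prod.cong refl) (simp add: emeasure_density)
  finally show "emeasure (density (Pi\<^sub>M I M) (\<lambda>x. \<Prod>i\<in>I. f i (x i))) (Pi\<^sub>E I A) =
    (\<Prod>i\<in>I. emeasure (density (M i) (f i)) (A i))" .
qed

lemma PiM_distr:
  assumes I: "finite I" and M: "\<And>i. i \<in> I \<Longrightarrow> prob_space (M i)"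
    and f: "\<And>i. i \<in> I \<Longrightarrow> f i \<in> M i \<rightarrow>\<^sub>M N i"
  shows "distr (Pi\<^sub>M I M) (Pi\<^sub>M I N) (\<lambda>x. \<lambda>i\<in>I. f i (x i)) = Pi\<^sub>M I (\<lambda>i. distr (M i) (N i) (f i))"
proof (rule PiM_eqI_prob_space[OF I])
  show "prob_space (distr (M i) (N i) (f i))" if "i \<in> I" for i
    by (rule prob_space.prob_space_distr[OF M[OF that] f[OF that]])
  show "sets (distr (Pi\<^sub>M I M) (Pi\<^sub>M I N) (\<lambda>x. \<lambda>i\<in>I. f i (x i))) =
      sets (Pi\<^sub>M I (\<lambda>i. distr (M i) (N i) (f i)))"
    by (auto intro!: sets_PiM_cong)
  fix A assume "\<And>i. i \<in> I \<Longrightarrow> A i \<in> sets (distr (M i) (N i) (f i))"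
  then have A: "A i \<in> sets (N i)" if "i \<in> I" for i using that by simp
  have meas: "(\<lambda>x. \<lambda>i\<in>I. f i (x i)) \<in> Pi\<^sub>M I M \<rightarrow>\<^sub>M Pi\<^sub>M I N"
    by (intro measurable_restrict measurable_PiM_component_compose f)
  have "(\<lambda>x. \<lambda>i\<in>I. f i (x i)) -` Pi\<^sub>E I A \<inter> space (Pi\<^sub>M I M) =
      Pi\<^sub>E I (\<lambda>i. f i -` A i \<inter> space (M i))"
    by (auto simp: space_PiM PiE_iff)
  then have "emeasure (distr (Pi\<^sub>M I M) (Pi\<^sub>M I N) (\<lambda>x. \<lambda>i\<in>I. f i (x i))) (Pi\<^sub>E I A) =
      emeasure (Pi\<^sub>M I M) (Pi\<^sub>E I (\<lambda>i. f i -` A i \<inter> space (M i)))"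
    using I A by (subst emeasure_distr[OF meas]) (auto intro!: sets_PiM_I_finite)
  also have "\<dots> = (\<Prod>i\<in>I. emeasure (M i) (f i -` A i \<inter> space (M i)))"
    using M f A by (intro emeasure_PiM_prob_space I) (auto intro!: measurable_sets)
  also have "\<dots> = (\<Prod>i\<in>I. emeasure (distr (M i) (N i) (f i)) (A i))"
    using f A by (intro prod.cong refl) (simp add: emeasure_distr)
  finally show "emeasure (distr (Pi\<^sub>M I M) (Pi\<^sub>M I N) (\<lambda>x. \<lambda>i\<in>I. f i (x i))) (Pi\<^sub>E I A) =
    (\<Prod>i\<in>I. emeasure (distr (M i) (N i) (f i)) (A i))" .
qed

text \<open>Independent centred coordinates are uncorrelated. This is the source of the
  orthogonality under the null.\<close>

lemma
  fixes g :: "'a \<Rightarrow> real"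
  assumes I: "finite I" and Q: "prob_space Q" and g: "integrable Q g" "integral\<^sup>L Q g = 0"
    and g2: "integrable Q (\<lambda>x. (g x)\<^sup>2)" and jk: "j \<in> I" "k \<in> I"
  shows integrable_PiM_pair: "integrable (Pi\<^sub>M I (\<lambda>_. Q)) (\<lambda>x. g (x j) * g (x k))"
    and integral_PiM_pair: "(\<integral>x. g (x j) * g (x k) \<partial>Pi\<^sub>M I (\<lambda>_. Q)) =
      (if j = k then \<integral>x. (g x)\<^sup>2 \<partial>Q else 0)"
proof -
  interpret Q: prob_space Q by fact
  interpret product_prob_space "\<lambda>_. Q" by (rule product_prob_spaceI) fact
  \<comment> \<open>Two separate factors treat both cases at once: for \<open>j = k\<close> they
    meet at the same index and give the square, otherwise they stay apart and each integrates to
    0.\<close>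
  define F where "F i x = (if i = j then g x else 1) * (if i = k then g x else 1)" for i x
  have F: "F i = (if i = j then if i = k then (\<lambda>x. (g x)\<^sup>2) else g else if i = k then g else (\<lambda>x. 1))" for i
    by (auto simp: F_def power2_eq_square)
  have iF: "integrable Q (F i)" for i
    unfolding F using g g2 by simp
  have eq: "(\<Prod>i\<in>I. F i (x i)) = g (x j) * g (x k)" for x
    unfolding F_def using I jk by (simp add: prod.distrib prod.delta)
  show "integrable (Pi\<^sub>M I (\<lambda>_. Q)) (\<lambda>x. g (x j) * g (x k))"
    using product_integrable_prod[of I F, OF I iF] by (simp add: eq)
  have "(\<integral>x. g (x j) * g (x k) \<partial>Pi\<^sub>M I (\<lambda>_. Q)) = (\<Prod>i\<in>I. integral\<^sup>L Q (F i))"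
    using product_integral_prod[of I F, OF I iF] by (simp add: eq)
  also have "\<dots> = (if j = k then \<integral>x. (g x)\<^sup>2 \<partial>Q else 0)"
  proof (cases "j = k")
    case True
    then have "integral\<^sup>L Q (F i) = (if i = j then \<integral>x. (g x)\<^sup>2 \<partial>Q else 1)" for i
      by (simp add: F Q.prob_space)
    then show ?thesis using True I jk by (simp add: prod.delta)
  next
    case False
    then have "integral\<^sup>L Q (F j) = 0" using g by (simp add: F)
    then show ?thesis using False I jk by (simp add: prod_zero_iff) blast
  qed
  finally show "(\<integral>x. g (x j) * g (x k) \<partial>Pi\<^sub>M I (\<lambda>_. Q)) =
      (if j = k then \<integral>x. (g x)\<^sup>2 \<partial>Q else 0)" .
qed

section \<open>Mixtures over private kernels\<close>

text \<open>On the set \<open>B\<close> where \<open>f\<close> exceeds \<open>C\<close> the excess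
  has integral 0, so it vanishes almost everywhere. Finiteness of \<open>C\<close> and of the
  measure is what allows the integral of the \<open>ennreal\<close> difference to be split.\<close>

lemma AE_density_le:
  fixes f :: "'a \<Rightarrow> ennreal"
  assumes "finite_measure M" and f [measurable]: "f \<in> borel_measurable M" and C: "C < \<infinity>"
    and le: "\<And>A. A \<in> sets M \<Longrightarrow> emeasure (density M f) A \<le> C * emeasure M A"
  shows "AE x in M. f x \<le> C"
proof -
  interpret finite_measure M by fact
  define B where "B = {x \<in> space M. C < f x}"
  have B [measurable]: "B \<in> sets M" by (simp add: B_def)
  have CB: "(\<integral>\<^sup>+x. C * indicator B x \<partial>M) = C * emeasure M B"
    by (simp add: nn_integral_cmult_indicator)
  have "(\<integral>\<^sup>+x. f x * indicator B x - C * indicator B x \<partial>M) =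
      (\<integral>\<^sup>+x. f x * indicator B x \<partial>M) - (\<integral>\<^sup>+x. C * indicator B x \<partial>M)"
  proof (rule nn_integral_diff)
    show "(\<integral>\<^sup>+x. C * indicator B x \<partial>M) \<noteq> \<infinity>"
      unfolding CB using C by (simp add: ennreal_mult_eq_top_iff less_top)
  qed (auto simp: B_def split: split_indicator)
  also have "\<dots> = emeasure (density M f) B - C * emeasure M B"
    by (simp add: CB emeasure_density)
  also have "\<dots> = 0"
  proof (rule diff_eq_0_ennreal[OF _ le[OF B]])
    show "emeasure (density M f) B < top"
      by (rule le_less_trans[OF le[OF B]]) (use C in \<open>simp add: ennreal_mult_eq_top_iff less_top[symmetric]\<close>)
  qed
  finally have "AE x in M. f x * indicator B x - C * indicator B x = 0"
    by (subst (asm) nn_integral_0_iff_AE) auto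
  then show ?thesis
    by (rule AE_mp) (use C in \<open>auto simp: B_def ennreal_minus_eq_0 less_top split: split_indicator
      intro!: AE_I2\<close>)
qed

text \<open>The upper bound is the domination of \<open>N\<close> by \<open>M\<close>. The lower
  bound comes from the opposite direction: the derivative \<open>g\<close> of \<open>M\<close> with
  respect to \<open>N\<close> is at most \<open>C\<close>, and \<open>f * g = 1\<close>.\<close>

lemma bounded_density:
  assumes M: "prob_space M" and N: "prob_space N" and sets: "sets N = sets M" and C: "C > 0"
    and NM: "\<And>A. A \<in> sets M \<Longrightarrow> measure N A \<le> C * measure M A"
    and MN: "\<And>A. A \<in> sets M \<Longrightarrow> measure M A \<le> C * measure N A"
  obtains L :: "'a \<Rightarrow> real" where "L \<in> borel_measurable M" "\<And>x. 1 / C \<le> L x" "\<And>x. L x \<le> C"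
    "N = density M (\<lambda>x. ennreal (L x))"
proof -
  interpret M: prob_space M by fact
  interpret N: prob_space N by fact
  have C1: "C \<ge> 1"
    using NM[OF sets.top] N.prob_space sets_eq_imp_space_eq[OF sets] M.prob_space by simp
  have eNM: "emeasure N A \<le> ennreal C * emeasure M A" if "A \<in> sets M" for A
    using NM[OF that] C 
    by (simp add: M.emeasure_eq_measure N.emeasure_eq_measure ennreal_mult[symmetric] ennreal_leI)
  have eMN: "emeasure M A \<le> ennreal C * emeasure N A" if "A \<in> sets M" for A
    using MN[OF that] C 
    by (simp add: M.emeasure_eq_measure N.emeasure_eq_measure ennreal_mult[symmetric] ennreal_leI)
  have ac: "absolutely_continuous M N"
    unfolding absolutely_continuous_def using eNM sets by (force simp: null_sets_def)
  define f where "f = RN_deriv M N"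
  have [measurable]: "f \<in> borel_measurable M" by (simp add: f_def)
  have Nf: "N = density M f"
    unfolding f_def by (rule M.density_RN_deriv[OF ac sets, symmetric])
  have up: "AE x in M. f x \<le> ennreal C"
    using eNM Nf by (intro AE_density_le) (auto simp: M.finite_measure_axioms)
  have ac': "absolutely_continuous N M"
    unfolding absolutely_continuous_def using eMN sets by (force simp: null_sets_def)
  have "AE x in N. RN_deriv N M x \<le> ennreal C"
  proof (intro AE_density_le)
    show "emeasure (density N (RN_deriv N M)) A \<le> ennreal C * emeasure N A" if "A \<in> sets N" for A
      using N.density_RN_deriv[OF ac'] sets eMN[of A] that by simp
  qed (auto simp: N.finite_measure_axioms)
  define g where "g = RN_deriv N M"
  have [measurable]: "g \<in> borel_measurable M" unfolding g_def using sets by (simp cong: measurable_cong_sets)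
  have gC: "AE x in M. f x > 0 \<longrightarrow> g x \<le> ennreal C"
    using \<open>AE x in N. RN_deriv N M x \<le> ennreal C\<close> by (subst (asm) (2) Nf) (simp add: AE_density g_def)
  have Mg: "M = density N g"
    unfolding g_def by (rule N.density_RN_deriv[OF ac' sets[symmetric], symmetric])
  \<comment> \<open>Going from \<open>M\<close> to \<open>N\<close> and back gives the density
    \<open>f * g\<close> of \<open>M\<close> with respect to itself, and uniqueness of densities
    forces it to be 1. In particular \<open>f\<close> is positive almost everywhere, so the bound on
    \<open>g\<close>, known only where \<open>f > 0\<close>, is available.\<close>
  have "density M (\<lambda>x. 1) = M" by (simp add: density_1)
  also have "\<dots> = density M (\<lambda>x. f x * g x)"
    by (subst Mg, subst Nf) (simp add: density_density_eq)
  finally have "AE x in M. 1 = f x * g x"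
    by (subst (asm) M.density_unique_iff) auto
  then have low: "AE x in M. ennreal (1 / C) \<le> f x"
    using gC
  proof eventually_elim
    case (elim x)
    then have "f x > 0" by (cases "f x = 0") (auto simp: zero_less_iff_neq_zero)
    with elim have "1 \<le> f x * ennreal C" by (metis mult_left_mono zero_le)
    then show ?case
    proof (cases "f x")
      case (real r)
      with \<open>1 \<le> f x * ennreal C\<close> have "1 \<le> r * C" using C
        by (simp add: ennreal_mult[symmetric] flip: ennreal_1)
      then show ?thesis using C real by (simp add: ennreal_leI divide_le_eq)
    qed simp
  qed
  \<comment> \<open>Clamping changes \<open>f\<close> on a null set only and makes the bounds hold
    everywhere, so that later arguments carry no exceptional sets. Both bounds survive because
    \<open>1 / C \<le> C\<close>, which follows from comparing total masses.\<close>
  define L where "L x = max (1 / C) (min C (enn2real (f x)))" for x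
  have [measurable]: "L \<in> borel_measurable M"
    unfolding L_def by measurable
  have "AE x in M. f x = ennreal (L x)"
    using up low
  proof eventually_elim
    case (elim x)
    show ?case
    proof (cases "f x")
      case (real r)
      then show ?thesis using elim C by (auto simp: L_def min_def max_def)
    next
      case top
      then show ?thesis using elim by (simp add: top_unique)
    qed
  qed
  then have "N = density M (\<lambda>x. ennreal (L x))"
    unfolding Nf by (intro density_cong) auto
  moreover have "1 / C \<le> C"
    using C1 by (intro order_trans[of "1 / C" 1 C]) auto
  ultimately show thesis
    by (intro that[of L]) (auto simp: L_def)
qed

text \<open>The density \<open>L\<close> of \<open>N\<close> lies in \<open>[1 / C, C]\<close>, and
  \<open>C + 1 / C \<ge> 2\<close> shows that its distance from 1 is at most \<open>C - 1\<close> on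
  either side. It will be applied with \<open>K x\<close> for \<open>N\<close> and the mixture over
  the data for \<open>M\<close>; the bound \<open>B\<close> secures integrability under
  both.\<close>

lemma ldp_integral_deviation:
  fixes G :: "'a \<Rightarrow> real"
  assumes M: "prob_space M" and N: "prob_space N" and sets: "sets N = sets M" and C: "C > 0"
    and NM: "\<And>A. A \<in> sets M \<Longrightarrow> measure N A \<le> C * measure M A"
    and MN: "\<And>A. A \<in> sets M \<Longrightarrow> measure M A \<le> C * measure N A"
    and G [measurable]: "G \<in> borel_measurable M" and B: "\<And>x. \<bar>G x\<bar> \<le> B"
  shows "integral\<^sup>L N G - integral\<^sup>L M G \<le> (C - 1) * (\<integral>x. \<bar>G x\<bar> \<partial>M)"
proof -
  interpret M: prob_space M by fact
  obtain L where L [measurable]: "L \<in> borel_measurable M" and L1: "\<And>x. 1 / C \<le> L x"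
    and L2: "\<And>x. L x \<le> C" and NL: "N = density M (\<lambda>x. ennreal (L x))"
    using bounded_density[OF M N sets C NM MN] by blast
  have L0: "0 \<le> L x" for x using L1[of x] C by (smt (verit) divide_pos_pos)
  have iG: "integrable M G"
    using B by (intro M.integrable_const_bound[of _ B]) auto
  have iLG: "integrable M (\<lambda>x. L x * G x)"
  proof (rule M.integrable_const_bound[of _ "C * B"])
    show "AE x in M. norm (L x * G x) \<le> C * B"
      using L0 L2 B C by (auto simp: abs_mult intro!: mult_mono)
  qed simp
  have dev: "(L x - 1) * G x \<le> (C - 1) * \<bar>G x\<bar>" for x
  proof -
    have "1 - 1 / C \<le> C - 1"
      using C zero_le_power2[of "C - 1"] by (simp add: field_simps power2_eq_square)
    then have "\<bar>L x - 1\<bar> \<le> C - 1" using L1[of x] L2[of x] by linarith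
    then have "\<bar>L x - 1\<bar> * \<bar>G x\<bar> \<le> (C - 1) * \<bar>G x\<bar>" by (rule mult_right_mono) simp
    then show ?thesis by (metis abs_le_D1 abs_mult)
  qed
  have "integral\<^sup>L N G - integral\<^sup>L M G = (\<integral>x. L x * G x \<partial>M) - integral\<^sup>L M G"
    unfolding NL using L0 by (simp add: integral_density)
  also have "\<dots> = (\<integral>x. (L x - 1) * G x \<partial>M)"
    using iG iLG by (simp add: left_diff_distrib)
  also have "\<dots> \<le> (\<integral>x. (C - 1) * \<bar>G x\<bar> \<partial>M)"
    using iG iLG dev by (intro integral_mono) (auto simp: left_diff_distrib)
  finally show ?thesis by simp
qed

section \<open>Averaging a private kernel over the data\<close>

lemma
  assumes P: "P \<in> space (prob_algebra M)" and K: "K \<in> M \<rightarrow>\<^sub>M prob_algebra N" and A: "A \<in> sets N"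
  shows integrable_measure_kernel: "integrable P (\<lambda>x. measure (K x) A)"
    and measure_bind_prob_algebra: "measure (P \<bind> K) A = (\<integral>x. measure (K x) A \<partial>P)"
proof -
  have sP [measurable_cong]: "sets P = sets M" and "prob_space P" using P by (auto simp: space_prob_algebra)
  interpret P: prob_space P by fact
  have Kx: "prob_space (K y)" if "y \<in> space P" for y
    using measurable_space[OF K] that sets_eq_imp_space_eq[OF sP] by (simp add: space_prob_algebra)
  have [measurable]: "(\<lambda>y. measure (K y) A) \<in> borel_measurable M"
    by (rule measurable_compose[OF K measurable_measure_prob_algebra[OF A]])
  show i: "integrable P (\<lambda>y. measure (K y) A)"
    using Kx by (intro P.integrable_const_bound[of _ 1]) (auto intro!: AE_I2 prob_space.prob_le_1)
  have "emeasure (P \<bind> K) A = (\<integral>\<^sup>+y. ennreal (measure (K y) A) \<partial>P)"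
    using Kx by (subst emeasure_bind_prob_algebra[OF P K A])
      (auto intro!: nn_integral_cong simp: finite_measure.emeasure_eq_measure prob_space.finite_measure)
  also have "\<dots> = ennreal (\<integral>y. measure (K y) A \<partial>P)"
    using i by (intro nn_integral_eq_integral) auto
  finally show "measure (P \<bind> K) A = (\<integral>y. measure (K y) A \<partial>P)"
    by (simp add: measure_def[of "P \<bind> K"] integral_nonneg_AE)
qed

text \<open>The privacy inequality is linear in each of its two kernel values, so either input can
  be averaged out, and then the other, without changing the factor \<open>C\<close>.\<close>

lemma
  assumes P: "P \<in> space (prob_algebra M)" and K: "K \<in> M \<rightarrow>\<^sub>M prob_algebra N"
    and ldp: "\<And>A x x'. A \<in> sets N \<Longrightarrow> x \<in> space M \<Longrightarrow> x' \<in> space M \<Longrightarrow>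
      measure (K x) A \<le> C * measure (K x') A"
    and A: "A \<in> sets N"
  shows ldp_le_bind: "x \<in> space M \<Longrightarrow> measure (K x) A \<le> C * measure (P \<bind> K) A"
    and ldp_bind_le: "x \<in> space M \<Longrightarrow> measure (P \<bind> K) A \<le> C * measure (K x) A"
    and ldp_bind_le_bind: "P' \<in> space (prob_algebra M) \<Longrightarrow>
      measure (P' \<bind> K) A \<le> C * measure (P \<bind> K) A"
proof -
  have sP: "space P = space M" and "prob_space P"
    using P sets_eq_imp_space_eq[of P M] by (auto simp: space_prob_algebra)
  interpret P: prob_space P by fact
  note i = integrable_measure_kernel[OF _ K A]
  note eq = measure_bind_prob_algebra[OF _ K A]
  show le: "measure (K x) A \<le> C * measure (P \<bind> K) A" if x: "x \<in> space M" for x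
  proof -
    have "(\<integral>y. measure (K x) A \<partial>P) \<le> (\<integral>y. C * measure (K y) A \<partial>P)"
      using i[OF P] by (intro integral_mono_AE) (auto intro!: AE_I2 ldp A x simp: sP)
    then show ?thesis by (simp add: eq[OF P] P.prob_space)
  qed
  show "measure (P \<bind> K) A \<le> C * measure (K x) A" if x: "x \<in> space M"
  proof -
    have "(\<integral>y. measure (K y) A \<partial>P) \<le> (\<integral>y. C * measure (K x) A \<partial>P)"
      using i[OF P] by (intro integral_mono_AE) (auto intro!: AE_I2 ldp A x simp: sP)
    then show ?thesis by (simp add: eq[OF P] P.prob_space)
  qed
  show "measure (P' \<bind> K) A \<le> C * measure (P \<bind> K) A" if P': "P' \<in> space (prob_algebra M)"
  proof -
    have sP': "space P' = space M" and "prob_space P'"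
      using P' sets_eq_imp_space_eq[of P' M] by (auto simp: space_prob_algebra)
    interpret P': prob_space P' by fact
    have "(\<integral>y. measure (K y) A \<partial>P') \<le> (\<integral>y. C * measure (P \<bind> K) A \<partial>P')"
      using i[OF P'] by (intro integral_mono_AE) (auto intro!: AE_I2 le simp: sP')
    then show ?thesis by (simp add: eq[OF P'] P'.prob_space)
  qed
qed

text \<open>Bessel's inequality in disguise: the \<open>g j\<close> are orthogonal, and the privacy constraint lets one
  replace \<open>K x\<close> by the mixture at the price of the factor \<open>C - 1\<close>. Arguing with the single function
  \<open>\<Sum>\<^sub>j g\<^sub>j(x) \<Delta>\<^sub>j(z)\<close> avoids a jointly measurable density of the kernel.\<close>

lemma ldp_sum_sq_le:
  fixes g :: "'j \<Rightarrow> 'a \<Rightarrow> real" and \<Delta> :: "'j \<Rightarrow> 'b \<Rightarrow> real"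
  assumes P: "prob_space P" and K: "K \<in> P \<rightarrow>\<^sub>M prob_algebra N" and C: "C > 0"
    and ldp: "\<And>A x x'. A \<in> sets N \<Longrightarrow> x \<in> space P \<Longrightarrow> x' \<in> space P \<Longrightarrow>
      measure (K x) A \<le> C * measure (K x') A"
    and J: "finite J"
    and g: "\<And>j. j \<in> J \<Longrightarrow> integrable P (g j)" "\<And>j. j \<in> J \<Longrightarrow> integral\<^sup>L P (g j) = 0"
    and gg: "\<And>j k. j \<in> J \<Longrightarrow> k \<in> J \<Longrightarrow> integrable P (\<lambda>x. g j x * g k x)"
      "\<And>j k. j \<in> J \<Longrightarrow> k \<in> J \<Longrightarrow> (\<integral>x. g j x * g k x \<partial>P) = (if j = k then v else 0)"
    and v: "v \<ge> 0"
    and \<Delta>: "\<And>j. j \<in> J \<Longrightarrow> \<Delta> j \<in> borel_measurable N" and B: "\<And>j z. j \<in> J \<Longrightarrow> \<bar>\<Delta> j z\<bar> \<le> B"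
    and eq: "\<And>j. j \<in> J \<Longrightarrow> (\<integral>z. (\<Delta> j z)\<^sup>2 \<partial>(P \<bind> K)) = (\<integral>x. g j x * (\<integral>z. \<Delta> j z \<partial>K x) \<partial>P)"
  shows "(\<Sum>j\<in>J. \<integral>z. (\<Delta> j z)\<^sup>2 \<partial>(P \<bind> K)) \<le> (C - 1)\<^sup>2 * v"
proof -
  interpret P: prob_space P by fact
  have PP: "P \<in> space (prob_algebra P)" using P by (simp add: space_prob_algebra)
  define m where "m = P \<bind> K"
  have sm [measurable_cong]: "sets m = sets N"
    unfolding m_def by (rule sets_bind'[OF PP K])
  interpret m: prob_space m
    unfolding m_def by (rule prob_space_bind'[OF PP K])
  have Kx: "prob_space (K x)" "sets (K x) = sets N" if "x \<in> space P" for x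
    using measurable_space[OF K that] by (simp_all add: space_prob_algebra)
  have \<Delta>m [measurable]: "\<Delta> j \<in> borel_measurable m" if "j \<in> J" for j
    using \<Delta>[OF that] sm by (simp cong: measurable_cong_sets)
  have i\<Delta>: "integrable m (\<Delta> j)" if "j \<in> J" for j
    using B that by (intro m.integrable_const_bound[of _ B]) auto
  have i\<Delta>\<Delta>: "integrable m (\<lambda>z. \<Delta> j z * \<Delta> k z)" if "j \<in> J" "k \<in> J" for j k
  proof (rule m.integrable_const_bound[of _ "B * B"])
    have "0 \<le> B" using B[OF that(1), of undefined] by linarith
    then show "AE z in m. norm (\<Delta> j z * \<Delta> k z) \<le> B * B"
      using B that by (auto simp: abs_mult intro!: mult_mono)
  qed (use that in measurable)
  have i\<Delta>K: "integrable (K x) (\<Delta> j)" if "j \<in> J" "x \<in> space P" for j x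
  proof -
    interpret Kx: prob_space "K x" using Kx that by simp
    show ?thesis using B that \<Delta>[OF that(1)] Kx(2)[OF that(2)]
      by (intro Kx.integrable_const_bound[of _ B]) (auto cong: measurable_cong_sets)
  qed
  define T where "T j x = (\<integral>z. \<Delta> j z \<partial>K x)" for j x
  have T [measurable]: "T j \<in> borel_measurable P" if "j \<in> J" for j
    unfolding T_def
    by (rule measurable_compose[OF measurable_prob_algebraD[OF K]
          integral_measurable_subprob_algebra[OF \<Delta>[OF that]]])
  have TB: "\<bar>T j x\<bar> \<le> B" if "j \<in> J" "x \<in> space P" for j x
  proof -
    interpret Kx: prob_space "K x" using Kx that by simp
    have "\<bar>T j x\<bar> \<le> (\<integral>z. \<bar>\<Delta> j z\<bar> \<partial>K x)" unfolding T_def by (rule integral_abs_bound)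
    also have "\<dots> \<le> (\<integral>z. B \<partial>K x)"
      using B that i\<Delta>K by (intro integral_mono) auto
    finally show ?thesis by (simp add: Kx.prob_space)
  qed
  have igT: "integrable P (\<lambda>x. g j x * T j x)" if "j \<in> J" for j
  proof (rule Bochner_Integration.integrable_bound[of P "\<lambda>x. B * g j x"])
    show "AE x in P. norm (g j x * T j x) \<le> norm (B * g j x)"
    proof (rule AE_I2)
      fix x assume "x \<in> space P"
      with TB[OF that this] have "\<bar>T j x\<bar> \<le> \<bar>B\<bar>" by linarith
      then have "\<bar>T j x\<bar> * \<bar>g j x\<bar> \<le> \<bar>B\<bar> * \<bar>g j x\<bar>" by (rule mult_right_mono) simp
      then show "norm (g j x * T j x) \<le> norm (B * g j x)" by (simp add: abs_mult mult.commute)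
    qed
  qed (use g(1)[OF that] T[OF that] in auto)
  define S where "S = (\<Sum>j\<in>J. \<integral>z. (\<Delta> j z)\<^sup>2 \<partial>m)"
  define q where "q j k = (\<integral>z. \<Delta> j z * \<Delta> k z \<partial>m)" for j k
  define G where "G x z = (\<Sum>j\<in>J. g j x * \<Delta> j z)" for x z
  have Gm [measurable]: "G x \<in> borel_measurable m" for x
    unfolding G_def by measurable
  have GB: "\<bar>G x z\<bar> \<le> (\<Sum>j\<in>J. \<bar>g j x\<bar> * B)" for x z
    unfolding G_def
    by (rule order_trans[OF sum_abs]) (auto simp: abs_mult intro!: sum_mono mult_left_mono B)
  have iG: "integrable m (G x)" for x
    unfolding G_def using i\<Delta> by auto
  have GG: "(G x z)\<^sup>2 = (\<Sum>j\<in>J. \<Sum>k\<in>J. (g j x * g k x) * (\<Delta> j z * \<Delta> k z))" for x z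
    unfolding G_def power2_eq_square sum_product by (simp add: mult_ac)
  have iGG: "integrable m (\<lambda>z. (G x z)\<^sup>2)" for x
    unfolding GG using i\<Delta>\<Delta> by auto
  have IG: "integral\<^sup>L m (G x) = (\<Sum>j\<in>J. g j x * integral\<^sup>L m (\<Delta> j))" for x
    unfolding G_def using i\<Delta> by (simp add: Bochner_Integration.integral_sum)
  have IGG: "(\<integral>z. (G x z)\<^sup>2 \<partial>m) = (\<Sum>j\<in>J. \<Sum>k\<in>J. (g j x * g k x) * q j k)" for x
    unfolding GG q_def using i\<Delta>\<Delta> by (simp add: Bochner_Integration.integral_sum integrable_sum)
  have IGK: "integral\<^sup>L (K x) (G x) = (\<Sum>j\<in>J. g j x * T j x)" if "x \<in> space P" for x
    unfolding G_def T_def using i\<Delta>K that by (simp add: Bochner_Integration.integral_sum)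
  \<comment> \<open>By \<open>eq\<close> the total of the squared norms is the integral over the
    data \<open>x\<close> of the mean of \<open>G x\<close> under \<open>K x\<close>. In this form
    the privacy constraint can be applied for each \<open>x\<close> separately.\<close>
  have S_eq: "S = (\<integral>x. (\<Sum>j\<in>J. g j x * T j x) \<partial>P)"
    using igT eq by (simp add: S_def Bochner_Integration.integral_sum T_def m_def)
  have q_S: "(\<Sum>j\<in>J. q j j) = S"
    by (simp add: S_def q_def power2_eq_square)
  have S0: "S \<ge> 0" unfolding S_def by (intro sum_nonneg integral_nonneg_AE) auto
  \<comment> \<open>The slack \<open>w > v\<close> allows division by \<open>w\<close> even when
    \<open>v = 0\<close>; it is removed at the end by letting \<open>w\<close> tend to
    \<open>v\<close>.\<close>
  have main: "S \<le> (C - 1)\<^sup>2 * w" if w: "w > v" for w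
  proof -
    have w0: "w > 0" using w v by simp
    \<comment> \<open>Replaces \<open>K x\<close> by the mixture \<open>m\<close> at the cost
      \<open>(C - 1)\<close> times the mean of \<open>\<bar>G x z\<bar>\<close>, then trades that
      absolute value for a square, which can be expanded into products of the
      \<open>g j\<close>.\<close>
    have pt: "(\<Sum>j\<in>J. g j x * T j x) \<le> (\<Sum>j\<in>J. g j x * integral\<^sup>L m (\<Delta> j)) +
        (\<Sum>j\<in>J. \<Sum>k\<in>J. (g j x * g k x) * q j k) / (2 * w) + w * (C - 1)\<^sup>2 / 2"
      if x: "x \<in> space P" for x
    proof -
      have "integral\<^sup>L (K x) (G x) - integral\<^sup>L m (G x) \<le> (C - 1) * (\<integral>z. \<bar>G x z\<bar> \<partial>m)"
      proof (rule ldp_integral_deviation[OF m.prob_space_axioms Kx(1)[OF x] _ C])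
        show "sets (K x) = sets m" using Kx(2)[OF x] sm by simp
        show "measure (K x) A \<le> C * measure m A" "measure m A \<le> C * measure (K x) A"
          if "A \<in> sets m" for A
          using ldp_le_bind[OF PP K ldp _ x] ldp_bind_le[OF PP K ldp _ x] that sm unfolding m_def by auto
      qed (auto intro: GB)
      also have "\<dots> = (\<integral>z. (C - 1) * \<bar>G x z\<bar> \<partial>m)" by simp
      also have "\<dots> \<le> (\<integral>z. (G x z)\<^sup>2 / (2 * w) + w * (C - 1)\<^sup>2 / 2 \<partial>m)"
      proof (rule integral_mono)
        fix z
        \<comment> \<open>Young's inequality with parameter \<open>w\<close>, tuned so that the
          quadratic term integrates to at most half of \<open>S\<close>.\<close>
        have "0 \<le> (\<bar>G x z\<bar> - w * (C - 1))\<^sup>2 / (2 * w)" using w0 by simp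
        also have "\<dots> = (G x z)\<^sup>2 / (2 * w) + w * (C - 1)\<^sup>2 / 2 - (C - 1) * \<bar>G x z\<bar>"
          using w0 by (simp add: power2_diff field_simps) (simp add: power2_eq_square algebra_simps)
        finally show "(C - 1) * \<bar>G x z\<bar> \<le> (G x z)\<^sup>2 / (2 * w) + w * (C - 1)\<^sup>2 / 2" by simp
      qed (use iG iGG in auto)
      also have "\<dots> = (\<integral>z. (G x z)\<^sup>2 \<partial>m) / (2 * w) + w * (C - 1)\<^sup>2 / 2"
        using iGG by (simp add: m.prob_space)
      finally show ?thesis using IG IGG IGK[OF x] by simp
    qed
    \<comment> \<open>After integration over \<open>x\<close> the linear term drops out because the
      \<open>g j\<close> are centred, and orthogonality leaves only the diagonal of the quadratic
      term, which is \<open>v * S\<close>.\<close>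
    have "S \<le> (\<integral>x. (\<Sum>j\<in>J. g j x * integral\<^sup>L m (\<Delta> j)) +
        (\<Sum>j\<in>J. \<Sum>k\<in>J. (g j x * g k x) * q j k) / (2 * w) + w * (C - 1)\<^sup>2 / 2 \<partial>P)"
      unfolding S_eq using igT g gg pt by (intro integral_mono) auto
    also have "\<dots> = (\<Sum>j\<in>J. integral\<^sup>L P (g j) * integral\<^sup>L m (\<Delta> j)) +
        (\<Sum>j\<in>J. \<Sum>k\<in>J. (\<integral>x. g j x * g k x \<partial>P) * q j k) / (2 * w) + w * (C - 1)\<^sup>2 / 2"
      using g gg by (simp add: Bochner_Integration.integral_sum P.prob_space)
    also have "(\<Sum>j\<in>J. integral\<^sup>L P (g j) * integral\<^sup>L m (\<Delta> j)) = 0"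
      using g(2) by simp
    also have "(\<Sum>j\<in>J. \<Sum>k\<in>J. (\<integral>x. g j x * g k x \<partial>P) * q j k) =
        (\<Sum>j\<in>J. \<Sum>k\<in>J. if j = k then v * q j j else 0)"
      using gg(2) by (intro sum.cong refl) auto
    also have "\<dots> = v * S"
      using J by (simp add: q_S[symmetric] sum_distrib_left)
    finally have "S \<le> v * S / (2 * w) + w * (C - 1)\<^sup>2 / 2" by simp
    \<comment> \<open>\<open>S\<close> occurs on both sides; since \<open>v < w\<close>, half of it
      can be absorbed on the left.\<close>
    also have "v * S / (2 * w) \<le> S / 2"
      using w w0 S0 by (simp add: field_simps mult_left_mono)
    finally show ?thesis by (simp add: mult.commute)
  qed
  have "S \<le> (C - 1)\<^sup>2 * v"
  proof (cases "C = 1")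
    case True
    then show ?thesis using main[of "v + 1"] by simp
  next
    case False
    then have E: "(C - 1)\<^sup>2 > 0" by simp
    have "S / (C - 1)\<^sup>2 \<le> v"
      by (rule dense_ge) (use main E in \<open>simp add: pos_divide_le_eq mult.commute\<close>)
    then show ?thesis using E by (simp add: pos_divide_le_eq mult.commute)
  qed
  then show ?thesis unfolding S_def m_def .
qed

section \<open>Testing from privatized data\<close>

lemma abs_ln_le:
  fixes x C :: real
  assumes "1 / C \<le> x" "x \<le> C" "C > 0"
  shows "\<bar>ln x\<bar> \<le> ln C"
proof -
  have x: "0 < x" using assms(1,3) by (meson divide_pos_pos less_le_trans zero_less_one)
  have "ln (1 / C) \<le> ln x" "ln x \<le> ln C" using x assms by (subst ln_le_cancel_iff; simp)+
  then show ?thesis using assms(3) by (simp add: ln_div abs_le_iff minus_le_iff)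
qed

text \<open>The bound for one user, with all alternatives \<open>j\<close> treated together. The
  divergence is passed on in Kullback-Leibler form because that form adds up over users; it is
  controlled by the mean of \<open>(L j z - 1)\<^sup>2\<close>, to which
  \<open>ldp_sum_sq_le\<close> applies.\<close>

lemma ldp_kl_sum_le:
  fixes f :: "'j \<Rightarrow> 'a \<Rightarrow> real"
  assumes P: "prob_space P" and K: "K \<in> P \<rightarrow>\<^sub>M prob_algebra N" and C: "C > 0"
    and ldp: "\<And>A x x'. A \<in> sets N \<Longrightarrow> x \<in> space P \<Longrightarrow> x' \<in> space P \<Longrightarrow>
      measure (K x) A \<le> C * measure (K x') A"
    and J: "finite J"
    and f: "\<And>j x. j \<in> J \<Longrightarrow> 0 \<le> f j x" "\<And>j. j \<in> J \<Longrightarrow> f j \<in> borel_measurable P"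
    and Pj: "\<And>j. j \<in> J \<Longrightarrow> prob_space (density P (\<lambda>x. ennreal (f j x)))"
    and gg: "\<And>j k. j \<in> J \<Longrightarrow> k \<in> J \<Longrightarrow> integrable P (\<lambda>x. (f j x - 1) * (f k x - 1))"
      "\<And>j k. j \<in> J \<Longrightarrow> k \<in> J \<Longrightarrow>
        (\<integral>x. (f j x - 1) * (f k x - 1) \<partial>P) = (if j = k then v else 0)"
    and v: "v \<ge> 0"
  obtains L :: "'j \<Rightarrow> 'b \<Rightarrow> real" where "\<And>j. j \<in> J \<Longrightarrow> L j \<in> borel_measurable N"
    "\<And>j z. j \<in> J \<Longrightarrow> 1 / C \<le> L j z" "\<And>j z. j \<in> J \<Longrightarrow> L j z \<le> C"
    "\<And>j. j \<in> J \<Longrightarrow>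
      density P (\<lambda>x. ennreal (f j x)) \<bind> K = density (P \<bind> K) (\<lambda>z. ennreal (L j z))"
    "(\<Sum>j\<in>J. \<integral>z. ln (L j z) \<partial>(density P (\<lambda>x. ennreal (f j x)) \<bind> K)) \<le> (C - 1)\<^sup>2 * v"
proof -
  interpret P: prob_space P by fact
  have PP: "P \<in> space (prob_algebra P)" using P by (simp add: space_prob_algebra)
  define m where "m = P \<bind> K"
  have sm [measurable_cong]: "sets m = sets N"
    unfolding m_def by (rule sets_bind'[OF PP K])
  interpret m: prob_space m
    unfolding m_def by (rule prob_space_bind'[OF PP K])
  define D where "D j = density P (\<lambda>x. ennreal (f j x))" for j
  define M where "M j = D j \<bind> K" for j
  have DP: "D j \<in> space (prob_algebra P)" if "j \<in> J" for j
    using Pj[OF that] by (simp add: space_prob_algebra D_def)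
  have pD: "prob_space (D j)" if "j \<in> J" for j using Pj[OF that] by (simp add: D_def)
  have sM: "sets (M j) = sets N" "prob_space (M j)" if "j \<in> J" for j
    using sets_bind'[OF DP[OF that] K] prob_space_bind'[OF DP[OF that] K] by (simp_all add: M_def)
  have Kx: "prob_space (K x)" "sets (K x) = sets N" if "x \<in> space P" for x
    using measurable_space[OF K that] by (simp_all add: space_prob_algebra)
  have mono: "measure (M j) A \<le> C * measure m A" "measure m A \<le> C * measure (M j) A"
    if j: "j \<in> J" and A: "A \<in> sets m" for j A
    unfolding M_def m_def
    using ldp_bind_le_bind[OF PP K ldp _ DP[OF j]] ldp_bind_le_bind[OF DP[OF j] K ldp _ PP] A sm
    by auto
  have "\<exists>L. L \<in> borel_measurable m \<and> (\<forall>z. 1 / C \<le> L z) \<and> (\<forall>z. L z \<le> C) \<and>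
      M j = density m (\<lambda>z. ennreal (L z))" if j: "j \<in> J" for j
    using bounded_density[of m "M j" C, OF m.prob_space_axioms sM(2)[OF j] _ C mono(1)[OF j] mono(2)[OF j]]
      sM(1)[OF j] sm by (smt (verit))
  then obtain L where L [measurable]: "\<And>j. j \<in> J \<Longrightarrow> L j \<in> borel_measurable m"
    and L1: "\<And>j z. j \<in> J \<Longrightarrow> 1 / C \<le> L j z" and L2: "\<And>j z. j \<in> J \<Longrightarrow> L j z \<le> C"
    and M_eq: "\<And>j. j \<in> J \<Longrightarrow> M j = density m (\<lambda>z. ennreal (L j z))"
    by metis
  have L0: "0 < L j z" if "j \<in> J" for j z
    using L1[OF that, of z] C by (smt (verit) divide_pos_pos)
  have if1: "integrable P (f j) \<and> integral\<^sup>L P (f j) = 1" if j: "j \<in> J" for j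
  proof -
    interpret Dj: prob_space "D j" by (rule pD[OF j])
    have "integrable (D j) (\<lambda>x. 1 :: real)" by simp
    then have "integrable P (f j)"
      unfolding D_def using f[OF j] by (simp add: integrable_density)
    moreover have "(\<integral>x. 1 \<partial>D j) = (\<integral>x. f j x * 1 \<partial>P)"
      unfolding D_def using f[OF j] by (subst integral_density) auto
    ultimately show ?thesis by (simp add: Dj.prob_space)
  qed
  define \<Delta> where "\<Delta> j z = L j z - 1" for j z
  have \<Delta>m [measurable]: "\<Delta> j \<in> borel_measurable m" if "j \<in> J" for j
    unfolding \<Delta>_def using that by measurable
  have \<Delta>B: "\<bar>\<Delta> j z\<bar> \<le> C + 1" if "j \<in> J" for j z
    using L0[OF that, of z] L2[OF that, of z] by (auto simp: \<Delta>_def)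
  have ibdd: "integrable m h" if "h \<in> borel_measurable m" "\<And>z. \<bar>h z\<bar> \<le> b" for h :: "'b \<Rightarrow> real" and b
    using that by (intro m.integrable_const_bound[of _ b]) auto
  have iL: "integrable m (L j)" if "j \<in> J" for j
    using L[OF that] L0[OF that] L2[OF that] by (intro ibdd[of _ C]) (simp_all add: abs_of_pos)
  have intL: "integral\<^sup>L m (L j) = 1" if "j \<in> J" for j
  proof -
    interpret Mj: prob_space "M j" by (rule sM(2)[OF that])
    have "(\<integral>z. 1 \<partial>M j) = (\<integral>z. L j z * 1 \<partial>m)"
      unfolding M_eq[OF that] using L[OF that] L0[OF that] by (subst integral_density) (auto simp: less_imp_le)
    then show ?thesis by (simp add: Mj.prob_space)
  qed
  have i\<Delta>2: "integrable m (\<lambda>z. (\<Delta> j z)\<^sup>2)" if "j \<in> J" for j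
  proof (rule ibdd)
    show "\<bar>(\<Delta> j z)\<^sup>2\<bar> \<le> (C + 1)\<^sup>2" for z
      using \<Delta>B[OF that, of z] C by (auto simp: abs_le_square_iff[symmetric])
  qed (use that in measurable)
  have i\<Delta>: "integrable m (\<Delta> j)" if "j \<in> J" for j
    using \<Delta>B[OF that] \<Delta>m[OF that] by (intro ibdd)
  \<comment> \<open>As \<open>L j = 1 + \<Delta> j\<close>, the squared norm is the difference of
    the means of the same function under two laws. This expression is linear in the laws, so each
    mean can be unrolled through the kernel.\<close>
  have sq: "(\<integral>z. (\<Delta> j z)\<^sup>2 \<partial>m) = (\<integral>z. \<Delta> j z \<partial>M j) - (\<integral>z. \<Delta> j z \<partial>m)" if j: "j \<in> J" for j
  proof -
    have "(\<integral>z. \<Delta> j z \<partial>M j) = (\<integral>z. L j z * \<Delta> j z \<partial>m)"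
      unfolding M_eq[OF j] using L[OF j] L0[OF j] \<Delta>m[OF j] by (subst integral_density) (auto simp: less_imp_le)
    also have "\<dots> = (\<integral>z. (\<Delta> j z)\<^sup>2 + \<Delta> j z \<partial>m)"
      by (intro Bochner_Integration.integral_cong) (auto simp: \<Delta>_def power2_eq_square algebra_simps)
    finally show ?thesis using i\<Delta>[OF j] i\<Delta>2[OF j] by simp
  qed
  \<comment> \<open>From \<open>ln t \<le> t - 1\<close> one gets
    \<open>t * ln t \<le> (t - 1)\<^sup>2 + (t - 1)\<close>, and the last term has mean 0.\<close>
  have ln_le: "(\<integral>z. ln (L j z) \<partial>M j) \<le> (\<integral>z. (\<Delta> j z)\<^sup>2 \<partial>m)" if j: "j \<in> J" for j
  proof -
    have "(\<integral>z. ln (L j z) \<partial>M j) = (\<integral>z. L j z * ln (L j z) \<partial>m)"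
      unfolding M_eq[OF j] using L[OF j] L0[OF j] by (subst integral_density) (auto simp: less_imp_le)
    also have "\<dots> \<le> (\<integral>z. (\<Delta> j z)\<^sup>2 + \<Delta> j z \<partial>m)"
    proof (rule integral_mono)
      show "integrable m (\<lambda>z. L j z * ln (L j z))"
      proof (rule ibdd)
        fix z
        have "\<bar>ln (L j z)\<bar> \<le> ln C" by (rule abs_ln_le[OF L1[OF j] L2[OF j] C])
        then show "\<bar>L j z * ln (L j z)\<bar> \<le> C * ln C"
          unfolding abs_mult using L2[OF j, of z] L0[OF j, of z] by (intro mult_mono) auto
      qed (use L[OF j] in measurable)
      show "L j z * ln (L j z) \<le> (\<Delta> j z)\<^sup>2 + \<Delta> j z" for z
      proof -
        have "L j z * ln (L j z) \<le> L j z * (L j z - 1)"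
          using L0[OF j, of z] ln_le_minus_one[of "L j z"] by (intro mult_left_mono) auto
        then show ?thesis by (simp add: \<Delta>_def power2_eq_square algebra_simps)
      qed
    qed (use i\<Delta>[OF j] i\<Delta>2[OF j] in auto)
    also have "\<dots> = (\<integral>z. (\<Delta> j z)\<^sup>2 \<partial>m)"
      using i\<Delta>[OF j] i\<Delta>2[OF j] iL[OF j] intL[OF j] by (simp add: \<Delta>_def m.prob_space)
    finally show ?thesis .
  qed
  show thesis
  proof (rule that[of L])
    show "L j \<in> borel_measurable N" if "j \<in> J" for j
      using L[OF that] sm by (simp cong: measurable_cong_sets)
    show "density P (\<lambda>x. ennreal (f j x)) \<bind> K = density (P \<bind> K) (\<lambda>z. ennreal (L j z))"
      if "j \<in> J" for j
      using M_eq[OF that] by (simp add: M_def D_def m_def)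
    have "(\<Sum>j\<in>J. \<integral>z. ln (L j z) \<partial>M j) \<le> (\<Sum>j\<in>J. \<integral>z. (\<Delta> j z)\<^sup>2 \<partial>(P \<bind> K))"
      using ln_le by (intro sum_mono) (simp add: m_def)
    also have "\<dots> \<le> (C - 1)\<^sup>2 * v"
    proof (rule ldp_sum_sq_le[OF P K C ldp J _ _ gg v])
      fix j assume j: "j \<in> J"
      show "\<Delta> j \<in> borel_measurable N" using \<Delta>m[OF j] sm by (simp cong: measurable_cong_sets)
      show "integrable P (\<lambda>x. f j x - 1)" using if1[OF j] by simp
      show "(\<integral>x. f j x - 1 \<partial>P) = 0" using if1[OF j] by (simp add: P.prob_space)
      have bind: "integral\<^sup>L (Q \<bind> K) (\<Delta> j) = (\<integral>x. (\<integral>z. \<Delta> j z \<partial>K x) \<partial>Q)"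
        if Q: "Q \<in> space (prob_algebra P)" for Q
      proof (rule integral_bind[where K = N and B = "C + 1" and B' = 1])
        have sQ: "sets Q = sets P" "prob_space Q" using Q by (auto simp: space_prob_algebra)
        then show "K \<in> Q \<rightarrow>\<^sub>M subprob_algebra N"
          using measurable_prob_algebraD[OF K] by (simp cong: measurable_cong_sets)
        show "finite_measure Q" using sQ by (simp add: prob_space.finite_measure)
        show "AE x in Q. emeasure (K x) (space (K x)) \<le> ennreal 1"
          using sets_eq_imp_space_eq[OF sQ(1)] Kx by (auto intro!: AE_I2 simp: prob_space.emeasure_space_1)
      qed (use \<Delta>m[OF j] sm \<Delta>B[OF j] in \<open>auto cong: measurable_cong_sets\<close>)
      define T where "T x = (\<integral>z. \<Delta> j z \<partial>K x)" for x
      have T [measurable]: "T \<in> borel_measurable P"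
        unfolding T_def using \<Delta>m[OF j] sm
        by (intro measurable_compose[OF measurable_prob_algebraD[OF K]
          integral_measurable_subprob_algebra]) (auto cong: measurable_cong_sets)
      have iT: "integrable P T" and ifT: "integrable P (\<lambda>x. f j x * T x)"
      proof -
        have TB: "\<bar>T x\<bar> \<le> C + 1" if "x \<in> space P" for x
        proof -
          interpret Kx: prob_space "K x" using Kx that by simp
          have i: "integrable (K x) (\<Delta> j)"
            using \<Delta>B[OF j] \<Delta>m[OF j] Kx(2)[OF that] sm
            by (intro Kx.integrable_const_bound[of _ "C + 1"]) (auto cong: measurable_cong_sets)
          have "\<bar>T x\<bar> \<le> (\<integral>z. \<bar>\<Delta> j z\<bar> \<partial>K x)" unfolding T_def by (rule integral_abs_bound)
          also have "\<dots> \<le> (\<integral>z. C + 1 \<partial>K x)"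
            using \<Delta>B[OF j] i by (intro integral_mono) auto
          finally show ?thesis by (simp add: Kx.prob_space)
        qed
        then show "integrable P T"
          by (intro P.integrable_const_bound[of _ "C + 1"]) auto
        show "integrable P (\<lambda>x. f j x * T x)"
        proof (rule Bochner_Integration.integrable_bound[of P "\<lambda>x. (C + 1) * f j x"])
          show "AE x in P. norm (f j x * T x) \<le> norm ((C + 1) * f j x)"
          proof (rule AE_I2)
            fix x assume "x \<in> space P"
            from mult_right_mono[OF TB[OF this], of "f j x"] f(1)[OF j, of x] C
            show "norm (f j x * T x) \<le> norm ((C + 1) * f j x)" by (simp add: abs_mult mult.commute)
          qed
        qed (use if1[OF j] f(2)[OF j] in auto)
      qed
      \<comment> \<open>Both laws are now traced back to the data, where their densities differ by
        \<open>f j x - 1\<close>. This is the identity that \<open>ldp_sum_sq_le\<close> requires of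
        \<Delta>.\<close>
      have "(\<integral>z. (\<Delta> j z)\<^sup>2 \<partial>(P \<bind> K)) = (\<integral>x. T x \<partial>D j) - (\<integral>x. T x \<partial>P)"
        using sq[OF j] bind[OF PP] bind[OF DP[OF j]] by (simp add: M_def m_def T_def)
      also have "(\<integral>x. T x \<partial>D j) = (\<integral>x. f j x * T x \<partial>P)"
        unfolding D_def using f[OF j] by (subst integral_density) auto
      also have "(\<integral>x. f j x * T x \<partial>P) - (\<integral>x. T x \<partial>P) = (\<integral>x. (f j x - 1) * T x \<partial>P)"
        using iT ifT by (simp add: left_diff_distrib)
      finally show "(\<integral>z. (\<Delta> j z)\<^sup>2 \<partial>(P \<bind> K)) = (\<integral>x. (f j x - 1) * (\<integral>z. \<Delta> j z \<partial>K x) \<partial>P)"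
        unfolding T_def .
    qed (use \<Delta>B in auto)
    finally show "(\<Sum>j\<in>J. \<integral>z. ln (L j z) \<partial>(density P (\<lambda>x. ennreal (f j x)) \<bind> K)) \<le> (C - 1)\<^sup>2 * v"
      by (simp add: M_def D_def)
  qed (use L1 L2 in auto)
qed

text \<open>Integrates \<open>L - (L ln L + 1/2) / ln D \<le> min(L, D)\<close>; the constant comes from
  \<open>- x ln x \<le> 1/2\<close>, and \<open>ln D \<ge> 1\<close> makes its contribution at most \<open>1/2\<close>.\<close>

lemma test_lower_bound:
  fixes L :: "'a \<Rightarrow> real" and D :: real
  assumes M: "prob_space M" and L: "L \<in> borel_measurable M" "\<And>x. 0 < L x"
    and N: "prob_space (density M (\<lambda>x. ennreal (L x)))"
    and i: "integrable (density M (\<lambda>x. ennreal (L x))) (\<lambda>x. ln (L x))"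
    and D: "ln D \<ge> 1" "D > 0" and A: "A \<in> sets M"
  shows "1 / 2 - (\<integral>x. ln (L x) \<partial>density M (\<lambda>x. ennreal (L x))) / ln D \<le>
    D * measure M A + measure (density M (\<lambda>x. ennreal (L x))) (space M - A)"
proof -
  interpret M: prob_space M by fact
  define N where "N = density M (\<lambda>x. ennreal (L x))"
  interpret N: prob_space N using assms(4) by (simp add: N_def)
  have [measurable]: "L \<in> borel_measurable M" "A \<in> sets M" by fact+
  have L0: "0 \<le> L x" for x using L(2)[of x] by simp
  have intN: "integral\<^sup>L N h = (\<integral>x. L x * h x \<partial>M)" "integrable N h \<longleftrightarrow> integrable M (\<lambda>x. L x * h x)"
    if [measurable]: "h \<in> borel_measurable M" for h :: "'a \<Rightarrow> real"
    using L0 by (simp_all add: N_def integral_density integrable_density)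
  have iLl: "integrable M (\<lambda>x. L x * ln (L x))"
    using i by (subst (asm) N_def[symmetric]) (simp add: intN)
  have iL: "integrable M L" using intN(2)[of "\<lambda>x. 1"] by simp
  have IL: "integral\<^sup>L M L = 1" using intN(1)[of "\<lambda>x. 1"] by (simp add: N.prob_space)
  have mN: "measure N (space M - A) = (\<integral>x. L x * indicator (space M - A) x \<partial>M)"
    using intN(1)[of "indicator (space M - A)"] by (simp add: N_def)
  have iA: "integrable M (\<lambda>x. L x * indicator (space M - A) x)"
    using integrable_real_mult_indicator[OF _ iL, of "space M - A"] by simp
  have iDA: "integrable M (\<lambda>x. D * indicator A x)"
    by (intro integrable_mult_right) (simp add: less_top[symmetric])
  have "1 / 2 - integral\<^sup>L N (\<lambda>x. ln (L x)) / ln D \<le> 1 - (integral\<^sup>L N (\<lambda>x. ln (L x)) + 1 / 2) / ln D"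
  proof -
    have "1 / l \<le> 1" if "1 \<le> l" for l :: real using that by simp
    from this[OF D(1)] show ?thesis by (simp add: add_divide_distrib)
  qed
  also have "\<dots> = (\<integral>x. L x - (L x * ln (L x) + 1 / 2) / ln D \<partial>M)"
    using iL iLl IL by (simp add: intN(1) M.prob_space)
  also have "\<dots> \<le> (\<integral>x. D * indicator A x + L x * indicator (space M - A) x \<partial>M)"
  proof (rule integral_mono)
    fix x assume x: "x \<in> space M"
    have Lx: "L x > 0" by fact
    \<comment> \<open>The maximum of \<open>- x * ln x\<close> is \<open>1 / e\<close>, rounded up
      to 1/2. The tangent inequality at \<open>1 / (2 * L x)\<close> gives this directly, because
      the leftover constant \<open>ln 2 - 1\<close> is not positive.\<close>
    have low: "L x * ln (L x) + 1 / 2 \<ge> 0"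
    proof -
      have "ln (1 / (2 * L x)) \<le> 1 / (2 * L x) - 1"
        using Lx by (intro ln_le_minus_one) auto
      then have "- ln 2 - ln (L x) \<le> 1 / (2 * L x) - 1"
        using Lx by (simp add: ln_div ln_mult)
      moreover have "ln 2 \<le> (1::real)" using ln_le_minus_one[of 2] by simp
      ultimately have "- ln (L x) \<le> 1 / (2 * L x)" by linarith
      then show ?thesis using Lx by (simp add: field_simps)
    qed
    \<comment> \<open>Below the threshold \<open>D\<close> only a nonnegative quantity is
      subtracted; above it the subtracted quantity already exceeds \<open>L x\<close>. The minimum
      lies below the integrand on the right for every choice of test region, since each point is
      charged either \<open>D\<close> or \<open>L x\<close>.\<close>
    have *: "L x - (L x * ln (L x) + 1 / 2) / ln D \<le> min (L x) D"
    proof (cases "L x \<le> D")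
      case True
      have "0 \<le> (L x * ln (L x) + 1 / 2) / ln D"
        using low D(1) by (intro divide_nonneg_nonneg) auto
      then show ?thesis using True by simp
    next
      case False
      then have "ln D \<le> ln (L x)" using D Lx by simp
      then have "L x * ln D \<le> L x * ln (L x)" using Lx by simp
      then have "L x * ln D \<le> L x * ln (L x) + 1 / 2" by simp
      moreover have "0 < ln D" using D(1) by linarith
      ultimately have "L x \<le> (L x * ln (L x) + 1 / 2) / ln D"
        by (subst pos_le_divide_eq)
      then show ?thesis using False D by simp
    qed
    then show "L x - (L x * ln (L x) + 1 / 2) / ln D \<le> D * indicator A x + L x * indicator (space M - A) x"
      using x by (auto split: split_indicator)
  qed (use iL iLl Bochner_Integration.integrable_add[OF iDA iA] in auto)
  also have "\<dots> = D * measure M A + measure N (space M - A)"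
    using Bochner_Integration.integral_add[OF iDA iA] by (simp add: mN)
  finally show ?thesis by (simp add: N_def)
qed

text \<open>The logarithm of the product likelihood ratio is a sum over the users, so its mean under
  the alternative is the sum of the one-user divergences. Each \<open>A j\<close> may use the whole
  privatized sample, and \<open>D\<close> is the price of a false rejection.\<close>

lemma ldp_tests_lower_bound:
  fixes f :: "'j \<Rightarrow> 'a \<Rightarrow> real" and C v D :: real
  assumes P: "prob_space P" and I: "finite I"
    and K: "\<And>i. i \<in> I \<Longrightarrow> K i \<in> P \<rightarrow>\<^sub>M prob_algebra N" and C: "C > 0"
    and ldp: "\<And>i A x x'. i \<in> I \<Longrightarrow> A \<in> sets N \<Longrightarrow> x \<in> space P \<Longrightarrow> x' \<in> space P \<Longrightarrow>
      measure (K i x) A \<le> C * measure (K i x') A"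
    and J: "finite J"
    and f: "\<And>j x. j \<in> J \<Longrightarrow> 0 \<le> f j x" "\<And>j. j \<in> J \<Longrightarrow> f j \<in> borel_measurable P"
    and Pj: "\<And>j. j \<in> J \<Longrightarrow> prob_space (density P (\<lambda>x. ennreal (f j x)))"
    and gg: "\<And>j k. j \<in> J \<Longrightarrow> k \<in> J \<Longrightarrow> integrable P (\<lambda>x. (f j x - 1) * (f k x - 1))"
      "\<And>j k. j \<in> J \<Longrightarrow> k \<in> J \<Longrightarrow>
        (\<integral>x. (f j x - 1) * (f k x - 1) \<partial>P) = (if j = k then v else 0)"
    and v: "v \<ge> 0" and D: "ln D \<ge> 1" "D > 0"
    and A: "\<And>j. j \<in> J \<Longrightarrow> A j \<in> sets (Pi\<^sub>M I (\<lambda>_. N))"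
  shows "card J / 2 - card I * ((C - 1)\<^sup>2 * v) / ln D \<le>
    (\<Sum>j\<in>J. D * measure (Pi\<^sub>M I (\<lambda>i. P \<bind> K i)) (A j) +
      measure (Pi\<^sub>M I (\<lambda>i. density P (\<lambda>x. ennreal (f j x)) \<bind> K i)) (space (Pi\<^sub>M I (\<lambda>_. N)) - A j))"
proof -
  have PP: "P \<in> space (prob_algebra P)" using P by (simp add: space_prob_algebra)
  define m where "m i = P \<bind> K i" for i
  define M where "M j i = density P (\<lambda>x. ennreal (f j x)) \<bind> K i" for j i
  have m: "prob_space (m i)" "sets (m i) = sets N" if "i \<in> I" for i
    unfolding m_def by (rule prob_space_bind'[OF PP K[OF that]] sets_bind'[OF PP K[OF that]])+
  have DP: "density P (\<lambda>x. ennreal (f j x)) \<in> space (prob_algebra P)" if "j \<in> J" for j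
    using Pj[OF that] by (simp add: space_prob_algebra)
  have M: "prob_space (M j i)" "sets (M j i) = sets N" if "i \<in> I" "j \<in> J" for i j
    unfolding M_def
    by (rule prob_space_bind'[OF DP[OF that(2)] K[OF that(1)]] sets_bind'[OF DP[OF that(2)] K[OF that(1)]])+
  have "\<forall>i\<in>I. \<exists>L. (\<forall>j\<in>J. L j \<in> borel_measurable N \<and> (\<forall>z. 1 / C \<le> L j z \<and> L j z \<le> C) \<and>
      M j i = density (m i) (\<lambda>z. ennreal (L j z))) \<and>
      (\<Sum>j\<in>J. \<integral>z. ln (L j z) \<partial>M j i) \<le> (C - 1)\<^sup>2 * v"
    unfolding M_def m_def
  proof
    fix i assume i: "i \<in> I"
    show "\<exists>L. (\<forall>j\<in>J. L j \<in> borel_measurable N \<and> (\<forall>z. 1 / C \<le> L j z \<and> L j z \<le> C) \<and>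
      density P (\<lambda>x. ennreal (f j x)) \<bind> K i = density (P \<bind> K i) (\<lambda>z. ennreal (L j z))) \<and>
      (\<Sum>j\<in>J. \<integral>z. ln (L j z) \<partial>(density P (\<lambda>x. ennreal (f j x)) \<bind> K i)) \<le> (C - 1)\<^sup>2 * v"
      by (rule ldp_kl_sum_le[OF P K[OF i] C ldp[OF i] J f Pj gg v]) (assumption | blast)+
  qed
  from bchoice[OF this] obtain L where
    LL: "\<forall>i\<in>I. (\<forall>j\<in>J. L i j \<in> borel_measurable N \<and> (\<forall>z. 1 / C \<le> L i j z \<and> L i j z \<le> C) \<and>
      M j i = density (m i) (\<lambda>z. ennreal (L i j z))) \<and>
      (\<Sum>j\<in>J. \<integral>z. ln (L i j z) \<partial>M j i) \<le> (C - 1)\<^sup>2 * v" by blast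
  have LN: "L i j \<in> borel_measurable N" and L1: "1 / C \<le> L i j z" and L2: "L i j z \<le> C"
    and M_eq: "M j i = density (m i) (\<lambda>z. ennreal (L i j z))" if "i \<in> I" "j \<in> J" for i j z
    using LL that by blast+
  have KL: "(\<Sum>j\<in>J. \<integral>z. ln (L i j z) \<partial>M j i) \<le> (C - 1)\<^sup>2 * v" if "i \<in> I" for i
    using LL that by blast
  have L0: "0 < L i j z" if "i \<in> I" "j \<in> J" for i j z
    using L1[OF that, of z] C by (smt (verit) divide_pos_pos)
  have Lm [measurable]: "L i j \<in> borel_measurable (m i)" if "i \<in> I" "j \<in> J" for i j
    using LN[OF that] m(2)[OF that(1)] by (simp cong: measurable_cong_sets)
  define \<Lambda> where "\<Lambda> = Pi\<^sub>M I m"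
  have s\<Lambda> [measurable_cong]: "sets \<Lambda> = sets (Pi\<^sub>M I (\<lambda>_. N))"
    unfolding \<Lambda>_def using m by (intro sets_PiM_cong) auto
  have p\<Lambda>: "prob_space \<Lambda>" unfolding \<Lambda>_def using m by (intro prob_space_PiM) auto
  have test: "1 / 2 - (\<Sum>i\<in>I. \<integral>z. ln (L i j z) \<partial>M j i) / ln D \<le> D * measure \<Lambda> (A j) +
      measure (Pi\<^sub>M I (M j)) (space (Pi\<^sub>M I (\<lambda>_. N)) - A j)" if j: "j \<in> J" for j
  proof -
    define R where R: "R z = (\<Prod>i\<in>I. L i j (z i))" for z
    have Lc [measurable]: "(\<lambda>z. L i j (z i)) \<in> borel_measurable \<Lambda>" if "i \<in> I" for i
      unfolding \<Lambda>_def by (rule measurable_PiM_component_compose[where M = m and f = "L i j", OF that Lm[OF that j]])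
    have Rm [measurable]: "R \<in> borel_measurable \<Lambda>" unfolding R by measurable
    have R0: "R z > 0" for z unfolding R using L0 j by (intro prod_pos) auto
    have pMj: "prob_space (Pi\<^sub>M I (M j))" using M j by (intro prob_space_PiM) auto
    have "Pi\<^sub>M I (M j) = Pi\<^sub>M I (\<lambda>i. density (m i) (\<lambda>z. ennreal (L i j z)))"
      using M_eq j by (intro PiM_cong) auto
    also have "\<dots> = density \<Lambda> (\<lambda>z. \<Prod>i\<in>I. ennreal (L i j (z i)))"
      unfolding \<Lambda>_def using m M(1) M_eq j Lm
      by (intro PiM_density[symmetric, OF I]) auto
    also have "\<dots> = density \<Lambda> (\<lambda>z. ennreal (R z))"
      unfolding R using L0 j by (intro density_cong) (auto simp: prod_ennreal less_imp_le)
    finally have eq: "Pi\<^sub>M I (M j) = density \<Lambda> (\<lambda>z. ennreal (R z))" .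
    interpret Mj: prob_space "Pi\<^sub>M I (M j)" by (rule pMj)
    have ne: "L i j z \<noteq> 0" if "i \<in> I" for i z using L0[OF that j, of z] by simp
    have lnR: "ln (R z) = (\<Sum>i\<in>I. ln (L i j (z i)))" for z
      unfolding R using I ne by (intro ln_prod) auto
    have Lc' [measurable]: "(\<lambda>z. L i j (z i)) \<in> borel_measurable (Pi\<^sub>M I (M j))" if "i \<in> I" for i
      unfolding eq using Lc[OF that] by simp
    have iln: "integrable (Pi\<^sub>M I (M j)) (\<lambda>z. ln (L i j (z i)))" if i: "i \<in> I" for i
    proof (rule Mj.integrable_const_bound)
      show "AE z in Pi\<^sub>M I (M j). norm (ln (L i j (z i))) \<le> ln C"
        using abs_ln_le[OF L1[OF i j] L2[OF i j] C] by simp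
    qed (use i in measurable)
    \<comment> \<open>A summand depends on one user only, and its marginal under the product law is
      \<open>M j i\<close>.\<close>
    have Iln: "(\<integral>z. ln (L i j (z i)) \<partial>Pi\<^sub>M I (M j)) = (\<integral>z. ln (L i j z) \<partial>M j i)" if i: "i \<in> I" for i
    proof -
      have "(\<lambda>z. ln (L i j z)) \<in> borel_measurable (M j i)"
        using Lm[OF i j] by (simp add: M_eq[OF i j])
      from integral_distr[OF measurable_component_singleton[OF i, of "M j"] this]
      have "(\<integral>z. ln (L i j z) \<partial>distr (Pi\<^sub>M I (M j)) (M j i) (\<lambda>z. z i)) =
          (\<integral>z. ln (L i j (z i)) \<partial>Pi\<^sub>M I (M j))" .
      then show ?thesis using M i j by (subst (asm) distr_PiM_component) auto
    qed
    have "1 / 2 - (\<integral>z. ln (R z) \<partial>Pi\<^sub>M I (M j)) / ln D \<le> D * measure \<Lambda> (A j) +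
      measure (Pi\<^sub>M I (M j)) (space \<Lambda> - A j)"
      using iln R0 A[OF j] s\<Lambda> D pMj unfolding eq
      by (intro test_lower_bound[OF p\<Lambda>]) (auto simp: lnR)
    moreover have "(\<integral>z. ln (R z) \<partial>Pi\<^sub>M I (M j)) = (\<Sum>i\<in>I. \<integral>z. ln (L i j z) \<partial>M j i)"
      unfolding lnR using iln Iln by (simp add: Bochner_Integration.integral_sum)
    ultimately show ?thesis using sets_eq_imp_space_eq[OF s\<Lambda>] by simp
  qed
  \<comment> \<open>The order of summation matters: for a fixed user the bound covers all
    \<open>j\<close> at once, so the total grows with \<open>card I\<close> and not with
    \<open>card I * card J\<close>.\<close>
  have "(\<Sum>j\<in>J. \<Sum>i\<in>I. \<integral>z. ln (L i j z) \<partial>M j i) \<le> card I * ((C - 1)\<^sup>2 * v)"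
    using sum_bounded_above[of I "\<lambda>i. \<Sum>j\<in>J. \<integral>z. ln (L i j z) \<partial>M j i", OF KL]
    by (subst sum.swap) simp
  then have "card J / 2 - card I * ((C - 1)\<^sup>2 * v) / ln D \<le>
      card J / 2 - (\<Sum>j\<in>J. \<Sum>i\<in>I. \<integral>z. ln (L i j z) \<partial>M j i) / ln D"
    using D(1) by (intro diff_left_mono divide_right_mono) auto
  also have "\<dots> = (\<Sum>j\<in>J. 1 / 2 - (\<Sum>i\<in>I. \<integral>z. ln (L i j z) \<partial>M j i) / ln D)"
    by (simp add: sum_subtractf sum_divide_distrib)
  also have "\<dots> \<le> (\<Sum>j\<in>J. D * measure \<Lambda> (A j) +
      measure (Pi\<^sub>M I (M j)) (space (Pi\<^sub>M I (\<lambda>_. N)) - A j))"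
    by (intro sum_mono test)
  finally show ?thesis by (simp add: \<Lambda>_def m_def[abs_def] M_def[abs_def])
qed

section \<open>The location family\<close>

text \<open>The Radon-Nikodym derivative in \<open>chi2\<close> is \<open>ennreal\<close>-valued and
  determined only almost everywhere; here it is exchanged for an explicit real density. Because
  \<open>r\<close> has mean 1, the divergence is the second moment of \<open>r - 1\<close>.\<close>

lemma
  fixes r :: "'a \<Rightarrow> real"
  assumes P: "prob_space P" and r [measurable]: "r \<in> borel_measurable P" and r0: "\<And>x. 0 \<le> r x"
    and Q: "prob_space (density P (\<lambda>x. ennreal (r x)))"
  shows chi2_density: "chi2 P (density P (\<lambda>x. ennreal (r x))) = (\<integral>\<^sup>+x. ennreal ((r x)\<^sup>2) \<partial>P) - 1"
    and integrable_density_prob: "integrable P r"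
    and integral_density_prob: "integral\<^sup>L P r = 1"
    and integrable_chi2: "chi2 P (density P (\<lambda>x. ennreal (r x))) < \<infinity> \<Longrightarrow>
      integrable P (\<lambda>x. (r x - 1)\<^sup>2)"
    and integral_chi2: "chi2 P (density P (\<lambda>x. ennreal (r x))) < \<infinity> \<Longrightarrow>
      (\<integral>x. (r x - 1)\<^sup>2 \<partial>P) = enn2real (chi2 P (density P (\<lambda>x. ennreal (r x))))"
proof -
  interpret P: prob_space P by fact
  define Q where "Q = density P (\<lambda>x. ennreal (r x))"
  interpret Q: prob_space Q using assms(4) by (simp add: Q_def)
  have "AE x in P. ennreal (r x) = RN_deriv P Q x"
    by (rule P.RN_deriv_unique) (auto simp: Q_def)
  then have "(\<integral>\<^sup>+x. (RN_deriv P Q x)\<^sup>2 \<partial>P) = (\<integral>\<^sup>+x. ennreal ((r x)\<^sup>2) \<partial>P)"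
    by (intro nn_integral_cong_AE) (erule eventually_mono, metis ennreal_power r0)
  moreover have "absolutely_continuous P Q"
    unfolding Q_def by (intro absolutely_continuousI_density) simp
  ultimately show chi2: "chi2 P (density P (\<lambda>x. ennreal (r x))) = (\<integral>\<^sup>+x. ennreal ((r x)\<^sup>2) \<partial>P) - 1"
    by (simp add: chi2_def Q_def)
  have "integrable Q (\<lambda>x. 1 :: real)" by simp
  then show ir: "integrable P r"
    unfolding Q_def using r0 by (simp add: integrable_density)
  have "(\<integral>x. 1 \<partial>Q) = (\<integral>x. r x * 1 \<partial>P)"
    unfolding Q_def using r0 by (subst integral_density) auto
  then show Ir: "integral\<^sup>L P r = 1" by (simp add: Q.prob_space)
  assume fin: "chi2 P (density P (\<lambda>x. ennreal (r x))) < \<infinity>"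
  then have "(\<integral>\<^sup>+x. ennreal ((r x)\<^sup>2) \<partial>P) < \<infinity>"
    unfolding chi2 by (cases "(\<integral>\<^sup>+x. ennreal ((r x)\<^sup>2) \<partial>P) = top") (auto simp: less_top[symmetric])
  then have ir2: "integrable P (\<lambda>x. (r x)\<^sup>2)"
    by (intro integrableI_nonneg) auto
  have sq: "(r x - 1)\<^sup>2 = (r x)\<^sup>2 - 2 * r x + 1" for x by (simp add: power2_diff)
  show "integrable P (\<lambda>x. (r x - 1)\<^sup>2)"
    unfolding sq using ir ir2 by auto
  have I2: "(\<integral>x. (r x - 1)\<^sup>2 \<partial>P) = (\<integral>x. (r x)\<^sup>2 \<partial>P) - 1"
    unfolding sq using ir ir2 Ir by (simp add: P.prob_space)
  \<comment> \<open>With this bound the truncated subtraction in \<open>ennreal\<close> agrees with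
    the real one.\<close>
  then have "(\<integral>x. (r x)\<^sup>2 \<partial>P) \<ge> 1"
    using integral_nonneg_AE[of "\<lambda>x. (r x - 1)\<^sup>2" P] by auto
  then show "(\<integral>x. (r x - 1)\<^sup>2 \<partial>P) = enn2real (chi2 P (density P (\<lambda>x. ennreal (r x))))"
    unfolding chi2 I2 using ir2
    by (simp add: nn_integral_eq_integral ennreal_minus flip: ennreal_1)
qed

section \<open>Translates of the noise density and their chi-square divergence\<close>

lemma coord_law_eq_density:
  fixes p :: "real \<Rightarrow> real"
  assumes p: "p \<in> borel_measurable borel" "\<And>x. p x > 0" and \<sigma>: "\<sigma> > 0"
    and \<mu>: "\<mu> = density lborel (\<lambda>x. ennreal (p x))"
  shows "coord_law \<mu> \<sigma> a =
    density (coord_law \<mu> \<sigma> 0) (\<lambda>x. ennreal (p ((x - a) / \<sigma>) / p (x / \<sigma>)))"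
proof (rule measure_eqI)
  have [measurable]: "p \<in> borel_measurable borel" by fact
  define b where "b = a / \<sigma>"
  have [simp]: "(\<sigma> * x - a) / \<sigma> = x - b" "\<sigma> * (b + x) = a + \<sigma> * x" for x
    using \<sigma> by (simp_all add: b_def field_simps)
  have [measurable_cong]: "sets \<mu> = sets borel" by (simp add: \<mu>)
  fix A assume "A \<in> sets (coord_law \<mu> \<sigma> a)"
  then have [measurable]: "A \<in> sets borel" by (simp add: coord_law_def)
  have "emeasure (coord_law \<mu> \<sigma> a) A = (\<integral>\<^sup>+x. indicator A x \<partial>coord_law \<mu> \<sigma> a)"
    by (simp add: coord_law_def)
  also have "\<dots> = (\<integral>\<^sup>+x. ennreal (p x) * indicator A (a + \<sigma> * x) \<partial>lborel)"
    unfolding coord_law_def by (subst nn_integral_distr) (auto simp: \<mu> nn_integral_density)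
  also have "\<dots> = (\<integral>\<^sup>+x. ennreal (p (x - b)) * indicator A (\<sigma> * x) \<partial>lborel)"
    by (subst (2) nn_integral_real_affine[where c = 1 and t = b]) auto
  also have "\<dots> = (\<integral>\<^sup>+x. ennreal (p x) * (ennreal (p (x - b) / p x) * indicator A (\<sigma> * x)) \<partial>lborel)"
    using p(2) by (intro nn_integral_cong)
      (simp add: mult.assoc[symmetric] ennreal_mult[symmetric] less_imp_le less_imp_neq[THEN not_sym])
  also have "\<dots> = (\<integral>\<^sup>+x. ennreal (p ((x - a) / \<sigma>) / p (x / \<sigma>)) * indicator A x \<partial>coord_law \<mu> \<sigma> 0)"
    unfolding coord_law_def using \<sigma> by (subst nn_integral_distr) (auto simp: \<mu> nn_integral_density)
  also have "\<dots> = emeasure (density (coord_law \<mu> \<sigma> 0) (\<lambda>x. ennreal (p ((x - a) / \<sigma>) / p (x / \<sigma>)))) A"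
    by (subst emeasure_density) (auto simp: coord_law_def)
  finally show "emeasure (coord_law \<mu> \<sigma> a) A =
    emeasure (density (coord_law \<mu> \<sigma> 0) (\<lambda>x. ennreal (p ((x - a) / \<sigma>) / p (x / \<sigma>)))) A" .
qed (simp add: coord_law_def)

text \<open>The squared ratio, weighted by \<open>p\<close>, is at most a constant times another
  translate of \<open>p\<close>, and a translate still has mass 1. Only the constant
  remains.\<close>

lemma chi2_coord_law_le:
  fixes p :: "real \<Rightarrow> real"
  assumes p: "p \<in> borel_measurable borel" "\<And>x. p x > 0" and \<sigma>: "\<sigma> > 0"
    and \<mu>: "\<mu> = density lborel (\<lambda>x. ennreal (p x))" "prob_space \<mu>"
    and c: "curvature_bounded_above c (potential p)"
  shows "chi2 (coord_law \<mu> \<sigma> 0) (coord_law \<mu> \<sigma> a) \<le> ennreal (exp (c * (a / \<sigma>)\<^sup>2) - 1)"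
proof -
  have [measurable]: "p \<in> borel_measurable borel" by fact
  have [measurable_cong]: "sets \<mu> = sets borel" by (simp add: \<mu>)
  define b where "b = a / \<sigma>"
  have [simp]: "(\<sigma> * x - a) / \<sigma> = x - b" for x
    using \<sigma> by (simp add: b_def field_simps)
  define r where "r x = p ((x - a) / \<sigma>) / p (x / \<sigma>)" for x
  have prob: "prob_space (coord_law \<mu> \<sigma> t)" for t
    unfolding coord_law_def by (intro prob_space.prob_space_distr \<mu>(2)) simp
  have eq: "coord_law \<mu> \<sigma> a = density (coord_law \<mu> \<sigma> 0) (\<lambda>x. ennreal (r x))"
    unfolding r_def by (rule coord_law_eq_density[OF p \<sigma> \<mu>(1)])
  have [measurable]: "r \<in> borel_measurable borel" unfolding r_def by measurable
  have chi2: "chi2 (coord_law \<mu> \<sigma> 0) (coord_law \<mu> \<sigma> a) =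
      (\<integral>\<^sup>+x. ennreal ((r x)\<^sup>2) \<partial>coord_law \<mu> \<sigma> 0) - 1"
    unfolding eq using prob[of a] p(2)
    by (intro chi2_density prob) (auto simp: eq, auto simp: coord_law_def r_def less_imp_le)
  \<comment> \<open>The points \<open>x\<close> and \<open>x - 2 * b\<close> lie at distance
    \<open>2 * b\<close>, so at their midpoint the curvature term equals
    \<open>c * b\<^sup>2 / 2\<close>; doubling the inequality to get a square of
    \<open>p (x - b)\<close> turns it into \<open>c * b\<^sup>2\<close>.\<close>
  have pt: "p x * (p (x - b) / p x)\<^sup>2 \<le> exp (c * b\<^sup>2) * p (x - 2 * b)" for x
  proof -
    have mid: "1 / 2 * x + (1 - 1 / 2) * (x - 2 * b) = x - b" by (simp add: algebra_simps)
    have "- (c / 2) * (1 / 2) * (1 - 1 / 2) * (x - (x - 2 * b))\<^sup>2 \<le>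
        potential p (1 / 2 * x + (1 - 1 / 2) * (x - 2 * b)) -
        (1 / 2 * potential p x + (1 - 1 / 2) * potential p (x - 2 * b))"
      by (rule c[unfolded curvature_bounded_above_def, rule_format]) simp
    then have "2 * ln (p (x - b)) \<le> ln (p x) + ln (p (x - 2 * b)) + c * b\<^sup>2"
      unfolding mid by (simp add: potential_def power_mult_distrib)
    then have "exp (2 * ln (p (x - b))) \<le> exp (ln (p x) + ln (p (x - 2 * b)) + c * b\<^sup>2)"
      by simp
    then have "(p (x - b))\<^sup>2 \<le> p x * p (x - 2 * b) * exp (c * b\<^sup>2)"
      using p(2) by (simp add: exp_add exp_double)
    then show ?thesis
      using p(2)[of x] by (simp add: power2_eq_square field_simps)
  qed
  have "(\<integral>\<^sup>+x. ennreal ((r x)\<^sup>2) \<partial>coord_law \<mu> \<sigma> 0) =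
      (\<integral>\<^sup>+x. ennreal (p x * (p (x - b) / p x)\<^sup>2) \<partial>lborel)"
    unfolding coord_law_def using \<sigma> p(2)
    by (subst nn_integral_distr)
       (auto simp: \<mu>(1) nn_integral_density r_def ennreal_mult less_imp_le)
  also have "\<dots> \<le> (\<integral>\<^sup>+x. ennreal (exp (c * b\<^sup>2)) * ennreal (p (x - 2 * b)) \<partial>lborel)"
    using pt p(2) by (intro nn_integral_mono) (simp add: ennreal_mult[symmetric] less_imp_le ennreal_leI)
  also have "\<dots> = ennreal (exp (c * b\<^sup>2)) * (\<integral>\<^sup>+x. ennreal (p (x - 2 * b)) \<partial>lborel)"
    by (rule nn_integral_cmult) simp
  also have "(\<integral>\<^sup>+x. ennreal (p (x - 2 * b)) \<partial>lborel) = (\<integral>\<^sup>+x. ennreal (p x) \<partial>lborel)"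
    by (subst nn_integral_real_affine[where c = 1 and t = "2 * b"]) auto
  also have "\<dots> = 1"
    using prob_space.emeasure_space_1[OF \<mu>(2)] by (simp add: \<mu>(1) emeasure_density)
  finally have "chi2 (coord_law \<mu> \<sigma> 0) (coord_law \<mu> \<sigma> a) \<le> ennreal (exp (c * b\<^sup>2)) - 1"
    unfolding chi2 by (intro ennreal_minus_mono) auto
  also have "\<dots> = ennreal (exp (c * b\<^sup>2) - 1)"
    by (metis ennreal_1 ennreal_minus zero_le_one)
  finally show ?thesis by (simp add: b_def)
qed

section \<open>The law of one observation as a product over coordinates\<close>

lemma borel_measurable_vec_lambda_PiM:
  "(\<lambda>x. \<chi> i. x i) \<in> Pi\<^sub>M (UNIV :: 'd::finite set) (\<lambda>_. borel :: real measure) \<rightarrow>\<^sub>M borel"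
  by (subst borel_measurable_euclidean_space) (auto simp: Basis_vec_def inner_axis)

text \<open>Moving the shift and scaling inside the product gives the form to which the product
  lemmas on densities and on orthogonality apply.\<close>

lemma signal_law_PiM:
  fixes \<theta> :: "real ^ 'd::finite"
  assumes \<mu>: "prob_space \<mu>" "sets \<mu> = sets borel"
  shows "signal_law \<mu> \<sigma> \<theta> =
    distr (Pi\<^sub>M UNIV (\<lambda>j. coord_law \<mu> \<sigma> (\<theta> $ j))) borel (\<lambda>x. \<chi> j. x j)"
proof -
  have [measurable_cong]: "sets \<mu> = sets borel" by fact
  have eq: "Pi\<^sub>M UNIV (\<lambda>j. coord_law \<mu> \<sigma> (\<theta> $ j)) =
      distr (Pi\<^sub>M UNIV (\<lambda>_. \<mu>)) (Pi\<^sub>M UNIV (\<lambda>_. borel)) (\<lambda>x. \<lambda>j\<in>UNIV. \<theta> $ j + \<sigma> * x j)"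
    unfolding coord_law_def using \<mu> by (intro PiM_distr[symmetric]) auto
  have meas: "(\<lambda>x. \<lambda>j\<in>UNIV. \<theta> $ j + \<sigma> * x j) \<in> Pi\<^sub>M UNIV (\<lambda>_. \<mu>) \<rightarrow>\<^sub>M Pi\<^sub>M UNIV (\<lambda>_. borel)"
    by measurable
  show ?thesis
    unfolding signal_law_def eq distr_distr[OF borel_measurable_vec_lambda_PiM meas]
    by (simp add: comp_def restrict_def)
qed

lemma prob_space_coord_law:
  assumes "prob_space \<mu>" "sets \<mu> = sets borel"
  shows "prob_space (coord_law \<mu> \<sigma> t)"
  unfolding coord_law_def using assms
  by (intro prob_space.prob_space_distr) (auto cong: measurable_cong_sets)

lemma prob_space_signal_law:
  fixes \<theta> :: "real ^ 'd::finite"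
  assumes "prob_space \<mu>" "sets \<mu> = sets borel"
  shows "prob_space (signal_law \<mu> \<sigma> \<theta>)"
proof -
  have "(\<lambda>x. \<chi> i. x i) \<in> Pi\<^sub>M UNIV (\<lambda>j. coord_law \<mu> \<sigma> (\<theta> $ j)) \<rightarrow>\<^sub>M (borel :: (real ^ 'd) measure)"
    using borel_measurable_vec_lambda_PiM
    by (simp add: coord_law_def cong: measurable_cong_sets sets_PiM_cong)
  then show ?thesis
    unfolding signal_law_PiM[OF assms]
    by (intro prob_space.prob_space_distr prob_space_PiM prob_space_coord_law assms)
qed

text \<open>Only coordinate \<open>j\<close> differs from the null, so every other factor of the
  likelihood ratio is 1.\<close>

lemma signal_law_axis:
  fixes j :: "'d::finite"
  assumes \<mu>: "prob_space \<mu>" "sets \<mu> = sets borel" and r: "r \<in> borel_measurable borel"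
    and eq: "coord_law \<mu> \<sigma> a = density (coord_law \<mu> \<sigma> 0) (\<lambda>x. ennreal (r x))"
  shows "signal_law \<mu> \<sigma> (axis j a :: real ^ 'd) =
    density (signal_law \<mu> \<sigma> 0) (\<lambda>x. ennreal (r (x $ j)))"
proof -
  let ?P = "Pi\<^sub>M (UNIV :: 'd set) (\<lambda>_. coord_law \<mu> \<sigma> 0)"
  have [measurable]: "r \<in> borel_measurable borel" by fact
  have sP [measurable_cong]: "sets ?P = sets (Pi\<^sub>M UNIV (\<lambda>_. borel))"
    by (intro sets_PiM_cong) (auto simp: coord_law_def)
  note [measurable] = borel_measurable_vec_lambda_PiM
  define F where "F k x = (if k = j then ennreal (r x) else 1)" for k x
  have coord: "coord_law \<mu> \<sigma> (axis j a $ k) = density (coord_law \<mu> \<sigma> 0) (F k)" for k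
    by (auto simp: axis_def F_def[abs_def] eq density_1)
  have "Pi\<^sub>M UNIV (\<lambda>k. coord_law \<mu> \<sigma> (axis j a $ k)) = density ?P (\<lambda>x. \<Prod>k\<in>UNIV. F k (x k))"
    unfolding coord
    by (intro PiM_density[symmetric])
       (auto simp: coord[symmetric] intro!: prob_space_coord_law \<mu>,
        auto simp: F_def[abs_def] coord_law_def)
  also have "(\<lambda>x. \<Prod>k\<in>UNIV. F k (x k)) = (\<lambda>x. ennreal (r (x j)))"
    by (auto simp: F_def prod.delta)
  finally show ?thesis
    unfolding signal_law_PiM[OF \<mu>] by (simp add: density_distr)
qed

section \<open>Reduction of the selection risk to coordinate tests\<close>

lemma privatized_law_PiM:
  assumes P: "prob_space P" "sets P = sets borel"
    and Q: "\<And>i. i \<in> {1..n} \<Longrightarrow> Q i \<in> borel \<rightarrow>\<^sub>M prob_algebra borel"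
  shows "privatized_law n Q P = Pi\<^sub>M {1..n} (\<lambda>i. P \<bind> Q i)"
  unfolding privatized_law_def
proof (rule PiM_bind)
  show "Q i \<in> P \<rightarrow>\<^sub>M prob_algebra borel" if "i \<in> {1..n}" for i
    using Q[OF that] P(2) by (simp cong: measurable_cong_sets)
qed (auto simp: P)

text \<open>If every risk were below the bound, then so would be those at 0 and at the points
  \<open>axis j a\<close>, and their weighted sum would contradict the bound for tests. Asking for a
  witness keeps the argument free of suprema.\<close>

lemma ldp_selector_risk_lower_bound:
  fixes Q :: "nat \<Rightarrow> real ^ 'd::finite \<Rightarrow> (real ^ 'd) measure"
  assumes \<mu>: "prob_space \<mu>" "sets \<mu> = sets borel"
    and r: "r \<in> borel_measurable borel" "\<And>x. 0 \<le> r x"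
    and eq: "coord_law \<mu> \<sigma> a = density (coord_law \<mu> \<sigma> 0) (\<lambda>x. ennreal (r x))"
    and chi2: "chi2 (coord_law \<mu> \<sigma> 0) (coord_law \<mu> \<sigma> a) < \<infinity>"
    and d: "CARD('d) \<ge> 4" and s: "s \<ge> 1" and a: "a > 0"
    and Q: "Q \<in> ldp_mechanisms n \<alpha>" and h: "h \<in> separable_selectors n"
  shows "\<exists>\<theta>\<in>Theta_plus s a. 1/4 * (1 - 2 * real n * (exp \<alpha> - 1)\<^sup>2
      / (real CARD('d) * ln (real CARD('d))) * enn2real (chi2 (coord_law \<mu> \<sigma> 0) (coord_law \<mu> \<sigma> a)))
    \<le> (\<integral>z. hamming (h z) (support_indicator \<theta>) \<partial>privatized_law n Q (signal_law \<mu> \<sigma> \<theta>))"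
proof (rule ccontr)
  define v where "v = enn2real (chi2 (coord_law \<mu> \<sigma> 0) (coord_law \<mu> \<sigma> a))"
  define d where "d = real CARD('d)"
  define \<beta> where "\<beta> = 1/4 * (1 - 2 * real n * (exp \<alpha> - 1)\<^sup>2 / (d * ln d) * v)"
  define risk where "risk \<theta> = (\<integral>z. hamming (h z) (support_indicator \<theta>)
    \<partial>privatized_law n Q (signal_law \<mu> \<sigma> \<theta>))" for \<theta> :: "real ^ 'd"
  assume "\<not> ?thesis"
  then have less: "risk \<theta> < \<beta>" if "\<theta> \<in> Theta_plus s a" for \<theta>
    using that by (auto simp: risk_def \<beta>_def d_def v_def not_le)
  \<comment> \<open>Here \<open>d \<ge> 4\<close> enters: it yields the condition
    \<open>ln d \<ge> 1\<close> of the testing bound.\<close>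
  have "exp 1 \<le> d" using exp_le d by (simp add: d_def)
  then have "ln (exp 1) \<le> ln d" by (subst ln_le_cancel_iff) (auto intro: less_le_trans[OF exp_gt_zero])
  then have ln_d: "1 \<le> ln d" by simp
  have d0: "0 < d" by (simp add: d_def)

  define N where "N = Pi\<^sub>M {1..n} (\<lambda>_. borel :: (real ^ 'd) measure)"
  \<comment> \<open>The selector's decision in coordinate \<open>j\<close>, read as the rejection
    region of a test of 0 against \<open>axis j a\<close>.\<close>
  define A where "A j = {z \<in> space N. h z j}" for j
  have hm [measurable]: "(\<lambda>z. h z j) \<in> N \<rightarrow>\<^sub>M count_space UNIV" for j
    using h by (simp add: separable_selectors_def N_def)
  have Am [measurable]: "A j \<in> sets N" for j unfolding A_def by measurable
  have Qm: "Q i \<in> borel \<rightarrow>\<^sub>M prob_algebra borel"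
    and ldp: "B \<in> sets borel \<Longrightarrow> measure (Q i x) B \<le> exp \<alpha> * measure (Q i x') B"
    if "i \<in> {1..n}" for i x x' B
    using Q that by (auto simp: ldp_mechanisms_def)
  have s\<theta>: "sets (signal_law \<mu> \<sigma> \<theta>) = sets borel" for \<theta> :: "real ^ 'd"
    by (simp add: signal_law_def)
  have p\<theta>: "prob_space (signal_law \<mu> \<sigma> \<theta>)" for \<theta> :: "real ^ 'd"
    by (rule prob_space_signal_law[OF \<mu>])
  define \<Lambda> where "\<Lambda> \<theta> = privatized_law n Q (signal_law \<mu> \<sigma> \<theta>)" for \<theta>
  have \<Lambda>: "\<Lambda> \<theta> = Pi\<^sub>M {1..n} (\<lambda>i. signal_law \<mu> \<sigma> \<theta> \<bind> Q i)" for \<theta>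
    unfolding \<Lambda>_def by (rule privatized_law_PiM[OF p\<theta> s\<theta> Qm])
  have sP: "signal_law \<mu> \<sigma> \<theta> \<in> space (prob_algebra borel)" for \<theta> :: "real ^ 'd"
    using s\<theta> p\<theta> by (simp add: space_prob_algebra)
  have p\<Lambda>: "prob_space (\<Lambda> \<theta>)" for \<theta>
    unfolding \<Lambda> by (intro prob_space_PiM prob_space_bind'[OF sP Qm])
  have s\<Lambda> [measurable_cong]: "sets (\<Lambda> \<theta>) = sets N" for \<theta>
    unfolding \<Lambda> N_def by (intro sets_PiM_cong refl sets_bind'[OF sP Qm])
  have space\<Lambda>: "space (\<Lambda> \<theta>) = space N" for \<theta>
    by (rule sets_eq_imp_space_eq[OF s\<Lambda>])

  have ih: "integrable (\<Lambda> \<theta>) (\<lambda>z. hamming (h z) \<eta>)" for \<theta> \<eta>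
  proof -
    interpret prob_space "\<Lambda> \<theta>" by (rule p\<Lambda>)
    show ?thesis unfolding hamming_def
      by (intro Bochner_Integration.integrable_sum integrable_const_bound[of _ 1]) auto
  qed
  \<comment> \<open>Under the null every selected coordinate is an error, so the risk collects the
    errors of the first kind of all \<open>d\<close> tests.\<close>
  have risk0: "(\<Sum>j\<in>UNIV. measure (\<Lambda> 0) (A j)) = risk 0"
  proof -
    interpret prob_space "\<Lambda> 0" by (rule p\<Lambda>)
    have "hamming (h z) (support_indicator 0) = (\<Sum>j\<in>UNIV. indicator (A j) z)" if "z \<in> space N" for z
      unfolding hamming_def using that
      by (intro sum.cong) (auto simp: A_def support_indicator_def indicator_def)
    then have "risk 0 = (\<integral>z. (\<Sum>j\<in>UNIV. indicator (A j) z) \<partial>\<Lambda> 0)"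
      unfolding risk_def \<Lambda>_def[symmetric]
      by (intro Bochner_Integration.integral_cong) (auto simp: space\<Lambda>)
    also have "\<dots> = (\<Sum>j\<in>UNIV. measure (\<Lambda> 0) (A j))"
      by (subst Bochner_Integration.integral_sum) (auto simp: s\<Lambda> less_top[symmetric])
    finally show ?thesis by simp
  qed
  \<comment> \<open>Under \<open>axis j a\<close> only the failure to select \<open>j\<close> is
    counted; false selections elsewhere are dropped.\<close>
  have riskj: "measure (\<Lambda> (axis j a)) (space N - A j) \<le> risk (axis j a)" for j
  proof -
    interpret prob_space "\<Lambda> (axis j a)" by (rule p\<Lambda>)
    have "measure (\<Lambda> (axis j a)) (space N - A j) = (\<integral>z. indicator (space N - A j) z \<partial>\<Lambda> (axis j a))"
      by (simp add: space\<Lambda>[symmetric] Int_absorb1)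
    also have "\<dots> \<le> (\<integral>z. hamming (h z) (support_indicator (axis j a)) \<partial>\<Lambda> (axis j a))"
    proof (rule integral_mono[OF _ ih])
      show "integrable (\<Lambda> (axis j a)) (indicator (space N - A j) :: _ \<Rightarrow> real)"
        by (simp add: less_top[symmetric] s\<Lambda>)
      fix z assume z: "z \<in> space (\<Lambda> (axis j a))"
      have "indicator (space N - A j) z = (of_bool (h z j \<noteq> support_indicator (axis j a) j) :: real)"
        using z a by (auto simp: space\<Lambda> A_def support_indicator_def)
      also have "\<dots> \<le> hamming (h z) (support_indicator (axis j a))"
        unfolding hamming_def by (rule member_le_sum) auto
      finally show "indicator (space N - A j) z \<le> hamming (h z) (support_indicator (axis j a))" .
    qed
    finally show ?thesis by (simp add: risk_def \<Lambda>_def)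
  qed

  define g where "g x = r x - 1" for x
  have [measurable]: "r \<in> borel_measurable borel" "g \<in> borel_measurable borel"
    using r by (simp_all add: g_def[abs_def])
  note prob0 = prob_space_coord_law[OF \<mu>, of \<sigma>]
  have pr: "prob_space (density (coord_law \<mu> \<sigma> 0) (\<lambda>x. ennreal (r x)))"
    using prob0[of a] eq by simp
  have rm: "r \<in> borel_measurable (coord_law \<mu> \<sigma> 0)" by (simp add: coord_law_def)
  note dens = prob0 rm r(2) pr
  interpret P0: prob_space "coord_law \<mu> \<sigma> 0" by (rule prob0)
  have ig: "integrable (coord_law \<mu> \<sigma> 0) g"
    using integrable_density_prob[OF dens] by (simp add: g_def[abs_def])
  have Ig: "integral\<^sup>L (coord_law \<mu> \<sigma> 0) g = 0"
    using integrable_density_prob[OF dens] integral_density_prob[OF dens]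
    by (simp add: g_def[abs_def] P0.prob_space)
  have ig2: "integrable (coord_law \<mu> \<sigma> 0) (\<lambda>x. (g x)\<^sup>2)"
    using integrable_chi2[OF dens] chi2 eq by (simp add: g_def[abs_def])
  have Ig2: "(\<integral>x. (g x)\<^sup>2 \<partial>coord_law \<mu> \<sigma> 0) = v"
    using integral_chi2[OF dens] chi2 eq by (simp add: g_def[abs_def] v_def)
  let ?PP = "Pi\<^sub>M (UNIV :: 'd set) (\<lambda>_. coord_law \<mu> \<sigma> 0)"
  have sPP [measurable_cong]: "sets ?PP = sets (Pi\<^sub>M UNIV (\<lambda>_. borel))"
    by (intro sets_PiM_cong) (auto simp: coord_law_def)
  note [measurable] = borel_measurable_vec_lambda_PiM
  have law0: "signal_law \<mu> \<sigma> (0 :: real ^ 'd) = distr ?PP borel (\<lambda>x. \<chi> j. x j)"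
    using signal_law_PiM[OF \<mu>, of \<sigma> "0 :: real ^ 'd"] by simp
  have ij: "integrable (signal_law \<mu> \<sigma> 0) (\<lambda>x. g (x $ j) * g (x $ k))" for j k :: 'd
    unfolding law0 using integrable_PiM_pair[OF finite[of UNIV] prob0 ig Ig ig2 UNIV_I UNIV_I, of j k]
    by (subst integrable_distr_eq) auto
  have Ij: "(\<integral>x. g (x $ j) * g (x $ k) \<partial>signal_law \<mu> \<sigma> 0) = (if j = k then v else 0)" for j k :: 'd
    unfolding law0 using integral_PiM_pair[OF finite[of UNIV] prob0 ig Ig ig2 UNIV_I UNIV_I, of j k] Ig2
    by (subst integral_distr) auto
  note axis = signal_law_axis[OF \<mu> r(1) eq]

  \<comment> \<open>The testing bound with weight \<open>D = d\<close>, so that the logarithm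
    becomes \<open>ln d\<close>.\<close>
  have "card (UNIV :: 'd set) / 2 - card {1..n} * ((exp \<alpha> - 1)\<^sup>2 * v) / ln d \<le>
    (\<Sum>j\<in>UNIV. d * measure (Pi\<^sub>M {1..n} (\<lambda>i. signal_law \<mu> \<sigma> (0 :: real ^ 'd) \<bind> Q i)) (A j) +
      measure (Pi\<^sub>M {1..n} (\<lambda>i. density (signal_law \<mu> \<sigma> 0) (\<lambda>x. ennreal (r (x $ j))) \<bind> Q i))
        (space (Pi\<^sub>M {1..n} (\<lambda>_. borel)) - A j))"
  proof (rule ldp_tests_lower_bound[OF p\<theta>])
    show "Q i \<in> signal_law \<mu> \<sigma> 0 \<rightarrow>\<^sub>M prob_algebra borel" if "i \<in> {1..n}" for i
      using Qm[OF that] s\<theta> by (simp cong: measurable_cong_sets)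
    show "prob_space (density (signal_law \<mu> \<sigma> 0) (\<lambda>x. ennreal (r (x $ j))))" for j :: 'd
      unfolding axis[symmetric] by (rule p\<theta>)
    show "integrable (signal_law \<mu> \<sigma> 0) (\<lambda>x. (r (x $ j) - 1) * (r (x $ k) - 1))" for j k :: 'd
      using ij by (simp add: g_def)
    show "(\<integral>x. (r (x $ j) - 1) * (r (x $ k) - 1) \<partial>signal_law \<mu> \<sigma> 0) = (if j = k then v else 0)"
      for j k :: 'd
      using Ij by (simp add: g_def)
    show "(\<lambda>x. r (x $ j)) \<in> borel_measurable (signal_law \<mu> \<sigma> 0)" for j :: 'd
      using s\<theta> by (simp cong: measurable_cong_sets)
  qed (use ldp r(2) ln_d d0 Am in \<open>auto simp: v_def N_def\<close>)
  also have "\<dots> = d * risk 0 + (\<Sum>j\<in>UNIV. measure (\<Lambda> (axis j a)) (space N - A j))"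
    unfolding axis[symmetric] \<Lambda>[symmetric] N_def[symmetric] sum.distrib
    by (simp add: sum_distrib_left[symmetric] risk0)
  also have "\<dots> < d * \<beta> + d * \<beta>"
  proof (rule add_strict_mono)
    show "d * risk 0 < d * \<beta>"
      using d0 by (intro mult_strict_left_mono less) (auto simp: Theta_plus_def intro!: exI[of _ "{}"])
    have "axis j a \<in> Theta_plus s a" for j :: 'd
      using s by (auto simp: Theta_plus_def axis_def intro!: exI[of _ "{j}"])
    then have "measure (\<Lambda> (axis j a)) (space N - A j) < \<beta>" for j
      using riskj less by (meson le_less_trans)
    then have "(\<Sum>j\<in>UNIV. measure (\<Lambda> (axis j a)) (space N - A j)) < (\<Sum>j\<in>(UNIV :: 'd set). \<beta>)"
      by (intro sum_strict_mono) auto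
    then show "(\<Sum>j\<in>UNIV. measure (\<Lambda> (axis j a)) (space N - A j)) < d * \<beta>"
      by (simp add: d_def)
  qed
  also have "d * \<beta> + d * \<beta> = d / 2 - n * ((exp \<alpha> - 1)\<^sup>2 * v) / ln d"
    using d0 ln_d by (simp add: \<beta>_def field_simps)
  finally show False by (simp add: d_def)
qed

theorem proposition3p6:
  fixes \<mu> :: "real measure" and p :: "real \<Rightarrow> real" and c \<sigma> a :: real
  assumes "\<sigma> > 0" and "c > 0" and "a > 0"
    and "prob_space \<mu>"
    and "distr \<mu> borel uminus = \<mu>"
    and "prob_space.variance \<mu> (\<lambda>x. x) = 1"
    and "strongly_log_concave_density c p"
    and "\<mu> = density lborel (\<lambda>x. ennreal (p x))"
  shows
    "(chi2 (coord_law \<mu> \<sigma> 0) (coord_law \<mu> \<sigma> a) < \<infinity> \<longrightarrow>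
       (\<forall>(\<alpha>::real) (s::nat) (n::nat).
          \<alpha> > 0 \<and> CARD('d::finite) \<ge> 4 \<and> 1 \<le> s \<and> s \<le> CARD('d) \<and> n \<ge> 1 \<longrightarrow>
          (INF Q \<in> (ldp_mechanisms n \<alpha> :: (nat \<Rightarrow> real ^ 'd \<Rightarrow> (real ^ 'd) measure) set).
             INF h \<in> separable_selectors n.
               SUP \<theta> \<in> Theta_plus s a.
                 ereal (\<integral>z. hamming (h z) (support_indicator \<theta>)
                          \<partial>privatized_law n Q (signal_law \<mu> \<sigma> \<theta>)))
          \<ge> ereal (1/4 * (1 - 2 * real n * (exp \<alpha> - 1)\<^sup>2
                     / (real CARD('d) * ln (real CARD('d)))
                     * enn2real (chi2 (coord_law \<mu> \<sigma> 0) (coord_law \<mu> \<sigma> a)))))) \<and>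
     (\<forall>c_plus > 0. curvature_bounded_above c_plus (potential p) \<longrightarrow>
        chi2 (coord_law \<mu> \<sigma> 0) (coord_law \<mu> \<sigma> a)
          \<le> ennreal (exp (c_plus * (a / \<sigma>)\<^sup>2) - 1))"
proof -
  obtain \<phi> where \<phi>: "convex_on UNIV \<phi>" and p: "\<And>x. p x = exp (- \<phi> x) * exp (- c * x\<^sup>2 / 2)"
    using assms(7) by (auto simp: strongly_log_concave_density_def)
  \<comment> \<open>The definition of a strongly log-concave density does not speak of
    measurability; it comes from the continuity of a finite convex function on the line.\<close>
  have "continuous_on UNIV \<phi>"
    by (rule convex_on_continuous[OF open_UNIV \<phi>])
  then have [measurable]: "\<phi> \<in> borel_measurable borel"
    by (rule borel_measurable_continuous_onI)
  have pm: "p \<in> borel_measurable borel" unfolding p[abs_def] by measurable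
  have p0: "p x > 0" for x by (simp add: p)
  have s\<mu>: "sets \<mu> = sets borel" by (simp add: assms(8))
  note dens = coord_law_eq_density[OF pm p0 assms(1,8), of a]
  show ?thesis
  proof (intro conjI impI allI INF_greatest)
    fix \<alpha> :: real and s n :: nat and Q :: "nat \<Rightarrow> real ^ 'd \<Rightarrow> (real ^ 'd) measure"
      and h :: "(nat \<Rightarrow> real ^ 'd) \<Rightarrow> 'd \<Rightarrow> bool"
    assume chi2: "chi2 (coord_law \<mu> \<sigma> 0) (coord_law \<mu> \<sigma> a) < \<infinity>"
      and H: "\<alpha> > 0 \<and> CARD('d) \<ge> 4 \<and> 1 \<le> s \<and> s \<le> CARD('d) \<and> n \<ge> 1"
      and Q: "Q \<in> ldp_mechanisms n \<alpha>" and h: "h \<in> separable_selectors n"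
    have "\<exists>\<theta>\<in>Theta_plus s a. 1/4 * (1 - 2 * real n * (exp \<alpha> - 1)\<^sup>2
        / (real CARD('d) * ln (real CARD('d))) * enn2real (chi2 (coord_law \<mu> \<sigma> 0) (coord_law \<mu> \<sigma> a)))
      \<le> (\<integral>z. hamming (h z) (support_indicator \<theta>) \<partial>privatized_law n Q (signal_law \<mu> \<sigma> \<theta>))"
    proof (rule ldp_selector_risk_lower_bound[OF assms(4) s\<mu> _ _ dens chi2 _ _ assms(3) Q h])
      show "(\<lambda>x. p ((x - a) / \<sigma>) / p (x / \<sigma>)) \<in> borel_measurable borel"
        using pm by measurable
      show "0 \<le> p ((x - a) / \<sigma>) / p (x / \<sigma>)" for x
        using p0 by (simp add: less_imp_le)
    qed (use H in auto)
    then obtain \<theta> where "\<theta> \<in> Theta_plus s a" "1/4 * (1 - 2 * real n * (exp \<alpha> - 1)\<^sup>2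
        / (real CARD('d) * ln (real CARD('d))) * enn2real (chi2 (coord_law \<mu> \<sigma> 0) (coord_law \<mu> \<sigma> a)))
      \<le> (\<integral>z. hamming (h z) (support_indicator \<theta>) \<partial>privatized_law n Q (signal_law \<mu> \<sigma> \<theta>))"
      by blast
    then show "ereal (1/4 * (1 - 2 * real n * (exp \<alpha> - 1)\<^sup>2
        / (real CARD('d) * ln (real CARD('d))) * enn2real (chi2 (coord_law \<mu> \<sigma> 0) (coord_law \<mu> \<sigma> a))))
      \<le> (SUP \<theta> \<in> Theta_plus s a. ereal (\<integral>z. hamming (h z) (support_indicator \<theta>)
          \<partial>privatized_law n Q (signal_law \<mu> \<sigma> \<theta>)))"
      by (intro SUP_upper2[of \<theta>]) auto
  next
    fix c_plus :: real
    assume "curvature_bounded_above c_plus (potential p)"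
    then show "chi2 (coord_law \<mu> \<sigma> 0) (coord_law \<mu> \<sigma> a) \<le> ennreal (exp (c_plus * (a / \<sigma>)\<^sup>2) - 1)"
      by (rule chi2_coord_law_le[OF pm p0 assms(1,8,4)])
  qed
qed

end
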